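(* The Novikov--Veselov flow preserves isothermic surfaces in any codimension, in the following sense. Let $M=T^2$ be a torus with a fixed complex structure, $z$ a holomorphic coordinate on its universal cover as in the context, $n\ge3$, and let $f(t):M\to S^n$ be a smooth family of conformal immersions whose normal variation is $\sigma=2\,\mathrm{Re}\,D_z\kappa$. If at some time $t$ the surface $f(t)$ is isothermic with $\kappa=\bar\kappa$ in the coordinate $z$, then at that time $$\mathrm{Im}\,(D_t\kappa)=0,$$ i.e. the reality condition $\kappa=\bar\kappa$ is preserved by the flow. Moreover, for such an isothermic surface $b=\langle\kappa,\kappa\rangle+\frac c4$ is an explicit solution of the $\bar\partial$-problem $\bar b_z=2\langle\sigma,\kappa\rangle$ (where $\bar b_z=\partial_z(\bar b)$).
   Context: Let $\mathbb R^{n+1,1}$ carry the Lorentzian form $\langle v,v\rangle=-v_0^2+\sum_{k=1}^{n+1}v_k^2$ (extended complex bilinearly), with forward light cone $\mathcal L_+$; identify $S^n$ with the projectivized light cone via $x\leftrightarrow[1:x]$. On the torus $M=T^2$ fix a nowhere vanishing holomorphic vector field $X$ and let $z$ be the holomorphic coordinate on the universal cover with $\frac{\partial}{\partial z}=\frac12(X-iJX)$, $J$ being the complex structure of $M$; $\partial_z,\partial_{\bar z}$ and $|dz|^2$ are globally defined on $M$. For a conformal immersion $f:M\to S^n$ there is a unique normalized lift $\psi:M\to\mathcal L_+$ such that $\psi(p)$ spans the null line $f(p)$ and $|d\psi|^2=|dz|^2$. Let $V=\mathrm{span}\{\psi,d\psi,\psi_{z\bar z}\}$, a rank $4$ subbundle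 of $M\times\mathbb R^{n+1,1}$ of signature $(3,1)$. The bundle $V^\perp$ carries the connection $D$ obtained by projecting the derivative to $V^\perp$; for families depending on $t$, $D_t$ denotes the projection of $\partial_t$ to $V(t)^\perp$. The equation $\psi_{zz}+\frac c2\psi=\kappa$ defines the Schwarzian derivative $c$ (a complex valued function) and the Hopf differential $\kappa\in\Gamma(V^\perp\otimes\mathbb C)$. The surface is isothermic (in the coordinate $z$) if $\kappa=\bar\kappa$. For a smooth family $f(t)$ of conformal immersions with normalized lifts $\psi(t)$ one has $$\psi_t=a\psi+b\psi_z+\bar b\psi_{\bar z}+\sigma$$ with $a$ real valued, $b$ complex valued and $\sigma\in\Gamma(V^\perp)$, the normal variation; conformality is equivalent to $\bar b_z=2\langle\sigma,\kappa\rangle$ and $a=-\mathrm{Re}\,b_z$, so $\sigma$ determines the deformation up to adding constants to $b$. The Novikov--Veselov flow is the one with $\sigma=\mathrm{Re}\,D_z\kappa$ (up to the constant factor $2$, i.e. rescaling of $t$), where $\mathrm{Re}\,D_z\kappa=\frac12(D_z\kappa+D_{\bar z}\bar\kappa)$. *)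

theory Defs
  imports "HOL-Analysis.Analysis"
begin

section \<open>Smooth maps\<close>

primrec k_smooth_on :: "nat \<Rightarrow> 'a::real_normed_vector set \<Rightarrow> ('a \<Rightarrow> 'b::real_normed_vector) \<Rightarrow> bool" where
  "k_smooth_on 0 S f \<longleftrightarrow> continuous_on S f"
| "k_smooth_on (Suc k) S f \<longleftrightarrow> (\<forall>x\<in>S. f differentiable (at x)) \<and>
     (\<forall>v. k_smooth_on k S (\<lambda>x. frechet_derivative f (at x) v))"

text \<open>Meant for open sets \<open>S\<close> only.\<close>
definition smooth_on :: "'a::real_normed_vector set \<Rightarrow> ('a \<Rightarrow> 'b::real_normed_vector) \<Rightarrow> bool" where
  "smooth_on S f \<longleftrightarrow> (\<forall>k. k_smooth_on k S f)"


section \<open>The torus\<close>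

text \<open>In the coordinate \<open>z\<close> given by the nowhere vanishing holomorphic vector field, the universal
  cover of the torus is the complex plane and the deck group is a lattice spanned by periods
  \<open>\<omega>1, \<omega>2\<close>.  Maps on the torus are doubly periodic maps on the plane.\<close>

definition lattice_basis :: "complex \<Rightarrow> complex \<Rightarrow> bool" where
  "lattice_basis \<omega>1 \<omega>2 \<longleftrightarrow> Im (cnj \<omega>1 * \<omega>2) \<noteq> 0"

definition doubly_periodic :: "complex \<Rightarrow> complex \<Rightarrow> (complex \<Rightarrow> 'b) \<Rightarrow> bool" where
  "doubly_periodic \<omega>1 \<omega>2 g \<longleftrightarrow> (\<forall>p. g (p + \<omega>1) = g p \<and> g (p + \<omega>2) = g p)"

definition conformal_immersion :: "complex \<Rightarrow> complex \<Rightarrow> (complex \<Rightarrow> real ^ 'm) \<Rightarrow> bool" where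
  "conformal_immersion \<omega>1 \<omega>2 f \<longleftrightarrow>
     smooth_on UNIV f \<and> doubly_periodic \<omega>1 \<omega>2 f \<and> (\<forall>p. f p \<in> sphere 0 1) \<and>
     (\<forall>p. \<exists>\<rho>>0. \<forall>u v. frechet_derivative f (at p) u \<bullet> frechet_derivative f (at p) v = \<rho> * (u \<bullet> v))"


section \<open>Lorentz space and its complexification\<close>

text \<open>With \<open>CARD('m) = n + 1\<close>, the Lorentz space is \<open>real ^ 'm option\<close>; the index \<open>None\<close> is the
  time direction.  The same formula on \<open>complex ^ 'm option\<close> is the complex bilinear extension.\<close>

definition lorentz :: "'a::comm_ring_1 ^ 'm::finite option \<Rightarrow> 'a ^ 'm option \<Rightarrow> 'a" where
  "lorentz v w = - (v $ None * w $ None) + (\<Sum>k\<in>UNIV. v $ Some k * w $ Some k)"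

definition forward_light_cone :: "(real ^ 'm::finite option) set" where
  "forward_light_cone = {v. lorentz v v = 0 \<and> v $ None > 0}"

definition light_vector :: "real ^ 'm \<Rightarrow> real ^ 'm::finite option" where
  "light_vector x = (\<chi> i. case i of None \<Rightarrow> 1 | Some k \<Rightarrow> x $ k)"

definition cvec :: "real ^ 'k \<Rightarrow> complex ^ 'k" where
  "cvec v = (\<chi> i. complex_of_real (v $ i))"

definition cnj_vec :: "complex ^ 'k \<Rightarrow> complex ^ 'k" where
  "cnj_vec v = (\<chi> i. cnj (v $ i))"

definition Im_vec :: "complex ^ 'k \<Rightarrow> real ^ 'k" where
  "Im_vec v = (\<chi> i. Im (v $ i))"


section \<open>Wirtinger derivatives\<close>

definition dz :: "(complex \<Rightarrow> complex) \<Rightarrow> complex \<Rightarrow> complex" where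
  "dz g p = (frechet_derivative g (at p) 1 - \<i> * frechet_derivative g (at p) \<i>) / 2"

definition dzbar :: "(complex \<Rightarrow> complex) \<Rightarrow> complex \<Rightarrow> complex" where
  "dzbar g p = (frechet_derivative g (at p) 1 + \<i> * frechet_derivative g (at p) \<i>) / 2"

definition dz_vec :: "(complex \<Rightarrow> complex ^ 'k) \<Rightarrow> complex \<Rightarrow> complex ^ 'k" where
  "dz_vec g p = (\<chi> i. dz (\<lambda>q. g q $ i) p)"

definition dzbar_vec :: "(complex \<Rightarrow> complex ^ 'k) \<Rightarrow> complex \<Rightarrow> complex ^ 'k" where
  "dzbar_vec g p = (\<chi> i. dzbar (\<lambda>q. g q $ i) p)"


section \<open>Normalized lifts and their invariants\<close>

definition normalized_lift ::
  "complex \<Rightarrow> complex \<Rightarrow> (complex \<Rightarrow> real ^ 'm) \<Rightarrow> (complex \<Rightarrow> real ^ 'm::finite option) \<Rightarrow> bool" where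
  "normalized_lift \<omega>1 \<omega>2 f \<psi> \<longleftrightarrow>
     smooth_on UNIV \<psi> \<and> doubly_periodic \<omega>1 \<omega>2 \<psi> \<and>
     (\<forall>p. \<psi> p \<in> forward_light_cone \<and> span {\<psi> p} = span {light_vector (f p)}) \<and>
     (\<forall>p v. lorentz (frechet_derivative \<psi> (at p) v) (frechet_derivative \<psi> (at p) v) = (norm v)\<^sup>2)"

abbreviation complexified :: "(complex \<Rightarrow> real ^ 'k) \<Rightarrow> complex \<Rightarrow> complex ^ 'k" where
  "complexified \<psi> \<equiv> \<lambda>p. cvec (\<psi> p)"

text \<open>Fibres of the complexifications of \<open>V\<close> and of its orthogonal complement; the complexified
  \<open>d\<psi>\<close> is spanned by \<open>\<psi>\<^sub>z\<close> and its conjugate, and \<open>vec.span\<close> is the complex span.\<close>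

definition V_fibre :: "(complex \<Rightarrow> real ^ 'm::finite option) \<Rightarrow> complex \<Rightarrow> (complex ^ 'm option) set" where
  "V_fibre \<psi> p = vec.span {cvec (\<psi> p), dz_vec (complexified \<psi>) p, dzbar_vec (complexified \<psi>) p,
     dzbar_vec (dz_vec (complexified \<psi>)) p}"

definition normal_fibre :: "(complex \<Rightarrow> real ^ 'm::finite option) \<Rightarrow> complex \<Rightarrow> (complex ^ 'm option) set" where
  "normal_fibre \<psi> p = {w. \<forall>v \<in> V_fibre \<psi> p. lorentz v w = 0}"

definition normal_proj ::
  "(complex \<Rightarrow> real ^ 'm::finite option) \<Rightarrow> complex \<Rightarrow> complex ^ 'm option \<Rightarrow> complex ^ 'm option" where
  "normal_proj \<psi> p v = (THE w. w \<in> normal_fibre \<psi> p \<and> v - w \<in> V_fibre \<psi> p)"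

definition schwarzian :: "(complex \<Rightarrow> real ^ 'm::finite option) \<Rightarrow> complex \<Rightarrow> complex" where
  "schwarzian \<psi> p = (THE c. dz_vec (dz_vec (complexified \<psi>)) p + (c / 2) *s cvec (\<psi> p) \<in> normal_fibre \<psi> p)"

definition hopf :: "(complex \<Rightarrow> real ^ 'm::finite option) \<Rightarrow> complex \<Rightarrow> complex ^ 'm option" where
  "hopf \<psi> p = dz_vec (dz_vec (complexified \<psi>)) p + (schwarzian \<psi> p / 2) *s cvec (\<psi> p)"

definition isothermic :: "(complex \<Rightarrow> real ^ 'm::finite option) \<Rightarrow> bool" where
  "isothermic \<psi> \<longleftrightarrow> (\<forall>p. hopf \<psi> p = cnj_vec (hopf \<psi> p))"

definition D_z ::
  "(complex \<Rightarrow> real ^ 'm::finite option) \<Rightarrow> (complex \<Rightarrow> complex ^ 'm option) \<Rightarrow> complex \<Rightarrow> complex ^ 'm option" where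
  "D_z \<psi> \<xi> p = normal_proj \<psi> p (dz_vec \<xi> p)"

definition D_zbar ::
  "(complex \<Rightarrow> real ^ 'm::finite option) \<Rightarrow> (complex \<Rightarrow> complex ^ 'm option) \<Rightarrow> complex \<Rightarrow> complex ^ 'm option" where
  "D_zbar \<psi> \<xi> p = normal_proj \<psi> p (dzbar_vec \<xi> p)"

definition Re_Dz_hopf :: "(complex \<Rightarrow> real ^ 'm::finite option) \<Rightarrow> complex \<Rightarrow> complex ^ 'm option" where
  "Re_Dz_hopf \<psi> p =
     (1 / 2) *s (D_z \<psi> (hopf \<psi>) p + D_zbar \<psi> (\<lambda>q. cnj_vec (hopf \<psi> q)) p)"


section \<open>Families of surfaces\<close>

definition D_t ::
  "(real \<Rightarrow> complex \<Rightarrow> real ^ 'm::finite option) \<Rightarrow> (real \<Rightarrow> complex \<Rightarrow> complex ^ 'm option) \<Rightarrow>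
    real \<Rightarrow> complex \<Rightarrow> complex ^ 'm option" where
  "D_t \<psi> \<xi> t p = normal_proj (\<psi> t) p (vector_derivative (\<lambda>s. \<xi> s p) (at t))"

text \<open>The condition forces \<open>\<sigma>\<close> to be real, since all the other terms of the decomposition are.\<close>
definition normal_variation ::
  "(real \<Rightarrow> complex \<Rightarrow> real ^ 'm::finite option) \<Rightarrow> real \<Rightarrow> (complex \<Rightarrow> complex ^ 'm option) \<Rightarrow> bool" where
  "normal_variation \<psi> t \<sigma> \<longleftrightarrow> (\<forall>p. \<sigma> p \<in> normal_fibre (\<psi> t) p) \<and>
     (\<exists>(a :: complex \<Rightarrow> real) (b :: complex \<Rightarrow> complex). \<forall>p.
        cvec (vector_derivative (\<lambda>s. \<psi> s p) (at t)) =
          complex_of_real (a p) *s cvec (\<psi> t p) + b p *s dz_vec (complexified (\<psi> t)) p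
          + cnj (b p) *s dzbar_vec (complexified (\<psi> t)) p + \<sigma> p)"

definition smooth_conformal_family ::
  "complex \<Rightarrow> complex \<Rightarrow> real set \<Rightarrow> (real \<Rightarrow> complex \<Rightarrow> real ^ 'm) \<Rightarrow> bool" where
  "smooth_conformal_family \<omega>1 \<omega>2 I f \<longleftrightarrow>
     smooth_on (I \<times> UNIV) (\<lambda>(t, p). f t p) \<and> (\<forall>t\<in>I. conformal_immersion \<omega>1 \<omega>2 (f t))"

end

theory Submission
  imports Defs "HOL-Complex_Analysis.Cauchy_Integral_Formula"
begin

text \<open>
  Write \<open>x\<close> for the complexified lift, \<open>c\<close> for the Schwarzian and \<open>\<kappa>\<close> for the Hopf differential,
  and \<open>w\<close> for the conjugate coordinate of \<open>z\<close>, so that \<open>x\<^sub>z\<^sub>z + c x / 2 = \<kappa>\<close>. The surface is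
  isothermic exactly when the wave-type operator \<open>L = \<partial>\<^sub>z\<partial>\<^sub>z - \<partial>\<^sub>w\<partial>\<^sub>w + e\<close> with \<open>e = (c - cnj c) /
  2\<close> annihilates \<open>x\<close>. The same operator measures the loss of isothermicity along a deformation:
  differentiating \<open>\<kappa>\<close> in time and using that \<open>T = \<psi>\<^sub>t\<close> is real, \<open>\<kappa>\<^sub>t\<close> minus its conjugate is \<open>L T\<close>
  up to a multiple of \<open>x\<close>. Since the projection to the normal bundle commutes with conjugation, it
  remains to see that \<open>L T\<close> is tangential, that is, lies in the fibre of \<open>V\<close> (\<open>normal_proj_real\<close>,
  \<open>isothermic_D_t_hopf_real\<close>).

  This is a computation of commutators of \<open>L\<close> with functions and with \<open>\<partial>\<^sub>z\<close>, \<open>\<partial>\<^sub>w\<close>. With \<open>h = \<langle>\<kappa>,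
  \<kappa>\<rangle>\<close>, the Gauss equation reads \<open>c\<^sub>w = 4 h\<^sub>z\<close> (\<open>dzbar_c\<close>), and \<open>L x = 0\<close> turns into the
  tangentiality of \<open>L \<kappa>\<close>, with explicit coefficients (\<open>L_\<kappa>\<close>); this replaces both the Codazzi and
  the Ricci equation. Modulo tangential terms every summand of \<open>L T\<close> is then a multiple of \<open>\<kappa>\<close>,
  and the coefficients cancel as soon as \<open>b = h + c / 4\<close> up to a constant (\<open>L_variation\<close>).

  That \<open>b\<close> has this form is the second half of the theorem together with Liouville: the Gauss
  equation shows that \<open>h + c / 4\<close> solves the equation \<open>\<partial>\<^sub>z (cnj b) = 2 \<langle>\<sigma>, \<kappa>\<rangle>\<close> (\<open>explicit_b\<close>), the
  coefficient \<open>b\<close> of the variation solves it because the family stays conformal, and the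
  difference of two solutions is a doubly periodic holomorphic function, hence constant
  (\<open>L_conformal_variation\<close>).

  The analytic input is that \<open>\<partial>\<^sub>t\<close>, \<open>\<partial>\<^sub>z\<close> and \<open>\<partial>\<^sub>w\<close> commute on the lifts. This needs the lifts to
  be smooth jointly in time and space, which holds since the normalized lift is the vector \<open>(1,
  f)\<close> divided by the length of \<open>\<partial>f/\<partial>x\<close> (\<open>smooth_family_lift\<close>).
\<close>

section \<open>Smooth maps and symmetry of second derivatives\<close>

abbreviation dir_deriv :: "'a::real_normed_vector \<Rightarrow> ('a \<Rightarrow> 'b::real_normed_vector) \<Rightarrow> 'a \<Rightarrow> 'b" where
  "dir_deriv v f \<equiv> \<lambda>x. frechet_derivative f (at x) v"

lemma dir_deriv_eqI: "(f has_derivative f') (at x) \<Longrightarrow> dir_deriv v f x = f' v"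
  using frechet_derivative_at by metis

lemma has_dir_deriv: "f differentiable (at x) \<Longrightarrow> (f has_derivative (\<lambda>v. dir_deriv v f x)) (at x)"
  by (simp add: frechet_derivative_works)

lemma dir_deriv_cong_open:
  assumes "open S" "x \<in> S" "\<And>y. y \<in> S \<Longrightarrow> f y = g y"
  shows "dir_deriv v f x = dir_deriv v g x"
proof -
  have "(f has_derivative f') (at x) \<longleftrightarrow> (g has_derivative f') (at x)" for f'
    using has_derivative_transform_within_open[OF _ assms(1,2)] assms(3) by metis
  then show ?thesis
    by (simp add: frechet_derivative_def)
qed

lemma k_smooth_on_cong_open:
  assumes "open S" "\<And>x. x \<in> S \<Longrightarrow> f x = g x"
  shows "k_smooth_on k S f \<longleftrightarrow> k_smooth_on k S g"
  using assms
proof (induction k arbitrary: f g)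
  case 0
  then show ?case by (auto intro: continuous_on_cong)
next
  case (Suc k)
  have "f differentiable at x \<longleftrightarrow> g differentiable at x" if "x \<in> S" for x
    unfolding differentiable_def
    using has_derivative_transform_within_open[OF _ Suc.prems(1) that] Suc.prems(2) by metis
  moreover have "k_smooth_on k S (dir_deriv v f) \<longleftrightarrow> k_smooth_on k S (dir_deriv v g)" for v
    using Suc.IH[of "dir_deriv v f" "dir_deriv v g"] Suc.prems dir_deriv_cong_open by blast
  ultimately show ?case by auto
qed

lemma smooth_on_cong_open:
  "open S \<Longrightarrow> (\<And>x. x \<in> S \<Longrightarrow> f x = g x) \<Longrightarrow> smooth_on S f \<longleftrightarrow> smooth_on S g"
  unfolding smooth_on_def using k_smooth_on_cong_open by metis

lemma k_smooth_on_SucD: "k_smooth_on (Suc k) S f \<Longrightarrow> k_smooth_on k S f"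
proof (induction k arbitrary: f)
  case 0
  then show ?case
    by (auto intro!: continuous_at_imp_continuous_on differentiable_imp_continuous_within)
next
  case (Suc k)
  then show ?case by auto
qed

lemma smooth_on_differentiable: "smooth_on S f \<Longrightarrow> x \<in> S \<Longrightarrow> f differentiable (at x)"
  unfolding smooth_on_def by (metis k_smooth_on.simps(2))

lemma smooth_on_continuous: "smooth_on S f \<Longrightarrow> continuous_on S f"
  unfolding smooth_on_def by (metis k_smooth_on.simps(1))

lemma smooth_on_dir_deriv: "smooth_on S f \<Longrightarrow> smooth_on S (dir_deriv v f)"
  unfolding smooth_on_def by (metis k_smooth_on.simps(2))

lemma k_smooth_on_const: "k_smooth_on k S (\<lambda>x. c)"
  by (induction k arbitrary: c) auto

lemma smooth_on_const: "smooth_on S (\<lambda>x. c)"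
  by (simp add: smooth_on_def k_smooth_on_const)

lemma k_smooth_on_add:
  assumes "open S" "k_smooth_on k S f" "k_smooth_on k S g"
  shows "k_smooth_on k S (\<lambda>x. f x + g x)"
  using assms
proof (induction k arbitrary: f g)
  case 0
  then show ?case by (auto intro: continuous_on_add)
next
  case (Suc k)
  have *: "dir_deriv v (\<lambda>x. f x + g x) x = dir_deriv v f x + dir_deriv v g x" if "x \<in> S" for x v
    using Suc.prems that by (intro dir_deriv_eqI has_derivative_add has_dir_deriv) auto
  have "k_smooth_on k S (dir_deriv v (\<lambda>x. f x + g x))" for v
    by (subst k_smooth_on_cong_open[OF Suc.prems(1) *]) (use Suc in auto)
  then show ?case using Suc.prems by (auto intro: differentiable_add)
qed

lemma smooth_on_add: "open S \<Longrightarrow> smooth_on S f \<Longrightarrow> smooth_on S g \<Longrightarrow> smooth_on S (\<lambda>x. f x + g x)"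
  by (simp add: smooth_on_def k_smooth_on_add)

lemma k_smooth_on_linear:
  assumes "bounded_linear L" "open S" "k_smooth_on k S f"
  shows "k_smooth_on k S (\<lambda>x. L (f x))"
  using assms(2-)
proof (induction k arbitrary: f)
  case 0
  then show ?case using bounded_linear.continuous_on[OF assms(1)] by auto
next
  case (Suc k)
  have d: "((\<lambda>x. L (f x)) has_derivative (\<lambda>v. L (dir_deriv v f x))) (at x)" if "x \<in> S" for x
    using Suc.prems that by (intro bounded_linear.has_derivative[OF assms(1)] has_dir_deriv) auto
  have *: "dir_deriv v (\<lambda>x. L (f x)) x = L (dir_deriv v f x)" if "x \<in> S" for x v
    using d[OF that] by (rule dir_deriv_eqI)
  have "k_smooth_on k S (dir_deriv v (\<lambda>x. L (f x)))" for v
    by (subst k_smooth_on_cong_open[OF Suc.prems(1) *]) (use Suc in auto)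
  then show ?case using d by (auto simp: differentiable_def)
qed

lemma smooth_on_linear: "bounded_linear L \<Longrightarrow> open S \<Longrightarrow> smooth_on S f \<Longrightarrow> smooth_on S (\<lambda>x. L (f x))"
  by (simp add: smooth_on_def k_smooth_on_linear)

lemma k_smooth_on_bilinear:
  assumes "bounded_bilinear B" "open S" "k_smooth_on k S f" "k_smooth_on k S g"
  shows "k_smooth_on k S (\<lambda>x. B (f x) (g x))"
  using assms(2-)
proof (induction k arbitrary: f g)
  case 0
  then show ?case using bounded_bilinear.continuous_on[OF assms(1)] by auto
next
  case (Suc k)
  have d: "((\<lambda>x. B (f x) (g x)) has_derivative
      (\<lambda>v. B (f x) (dir_deriv v g x) + B (dir_deriv v f x) (g x))) (at x)" if "x \<in> S" for x
    using Suc.prems that by (intro bounded_bilinear.FDERIV[OF assms(1)] has_dir_deriv) auto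
  have *: "dir_deriv v (\<lambda>x. B (f x) (g x)) x
      = B (f x) (dir_deriv v g x) + B (dir_deriv v f x) (g x)"
    if "x \<in> S" for x v
    using d[OF that] by (rule dir_deriv_eqI)
  have "k_smooth_on k S (\<lambda>x. B (f x) (dir_deriv v g x) + B (dir_deriv v f x) (g x))" for v
    using Suc.prems(2,3)
    by (intro k_smooth_on_add[OF Suc.prems(1)] Suc.IH[OF Suc.prems(1)])
      (simp_all add: k_smooth_on_SucD[OF Suc.prems(2)] k_smooth_on_SucD[OF Suc.prems(3)])
  then have "k_smooth_on k S (dir_deriv v (\<lambda>x. B (f x) (g x)))" for v
    using k_smooth_on_cong_open[OF Suc.prems(1) *] by simp
  then show ?case using d by (auto simp: differentiable_def)
qed

lemma smooth_on_bilinear: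
  "bounded_bilinear B \<Longrightarrow> open S \<Longrightarrow> smooth_on S f \<Longrightarrow> smooth_on S g \<Longrightarrow> smooth_on S (\<lambda>x. B (f x) (g x))"
  by (simp add: smooth_on_def k_smooth_on_bilinear)

text \<open>The exponent stays arbitrary because differentiation lowers it by one.\<close>

lemma k_smooth_on_powr:
  fixes g :: "'a::real_normed_vector \<Rightarrow> real"
  assumes "open S" "k_smooth_on k S g" "\<And>x. x \<in> S \<Longrightarrow> g x > 0"
  shows "k_smooth_on k S (\<lambda>x. g x powr r)"
  using assms
proof (induction k arbitrary: r)
  case 0
  then have "continuous_on S g" "\<forall>x\<in>S. g x \<noteq> 0" by fastforce+
  then show ?case by (simp add: continuous_on_powr[OF _ continuous_on_const])
next
  case (Suc k)
  have d: "((\<lambda>x. g x powr r) has_derivative (\<lambda>v. (r * g x powr (r - 1)) * dir_deriv v g x)) (at x)"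
    if "x \<in> S" for x
  proof -
    have "((\<lambda>y. y powr r) has_derivative (\<lambda>h. (r * g x powr (r - 1)) * h)) (at (g x))"
      using Suc.prems(3)[OF that] has_real_derivative_powr[of "g x" r]
      by (simp add: has_field_derivative_def)
    moreover have "(g has_derivative (\<lambda>v. dir_deriv v g x)) (at x)"
      using Suc.prems(2) that by (auto intro: has_dir_deriv)
    ultimately show ?thesis
      using has_derivative_compose[where f = g and g = "\<lambda>y. y powr r"] by blast
  qed
  have *: "dir_deriv v (\<lambda>x. g x powr r) x = (r * g x powr (r - 1)) * dir_deriv v g x"
    if "x \<in> S" for x v
    using d[OF that] by (rule dir_deriv_eqI)
  have "k_smooth_on k S (\<lambda>x. (r * g x powr (r - 1)) * dir_deriv v g x)" for v
    using Suc.prems k_smooth_on_SucD[OF Suc.prems(2)]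
    by (intro k_smooth_on_bilinear[OF bounded_bilinear_mult] k_smooth_on_const Suc.IH) auto
  then have "k_smooth_on k S (dir_deriv v (\<lambda>x. g x powr r))" for v
    using k_smooth_on_cong_open[OF Suc.prems(1) *] by auto
  then show ?case using d by (auto simp: differentiable_def)
qed

lemma smooth_on_powr:
  fixes g :: "'a::real_normed_vector \<Rightarrow> real"
  shows "open S \<Longrightarrow> smooth_on S g \<Longrightarrow> (\<And>x. x \<in> S \<Longrightarrow> g x > 0) \<Longrightarrow> smooth_on S (\<lambda>x. g x powr r)"
  by (simp add: smooth_on_def k_smooth_on_powr)

lemma dir_deriv_affine:
  assumes "bounded_linear L" "f differentiable (at (a + L x))"
  shows "dir_deriv v (\<lambda>y. f (a + L y)) x = dir_deriv (L v) f (a + L x)"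
    and "(\<lambda>y. f (a + L y)) differentiable (at x)"
proof -
  have "((\<lambda>y. a + L y) has_derivative L) (at x)"
    using assms(1) by (auto intro!: derivative_eq_intros bounded_linear_imp_has_derivative)
  from has_derivative_compose[OF this has_dir_deriv[OF assms(2)]]
  have d: "((\<lambda>y. f (a + L y)) has_derivative (\<lambda>v. dir_deriv (L v) f (a + L x))) (at x)" .
  show "dir_deriv v (\<lambda>y. f (a + L y)) x = dir_deriv (L v) f (a + L x)"
    using d by (rule dir_deriv_eqI)
  show "(\<lambda>y. f (a + L y)) differentiable (at x)" using d by (auto simp: differentiable_def)
qed

lemma k_smooth_on_affine:
  assumes "bounded_linear L" "open T" "\<And>x. x \<in> T \<Longrightarrow> a + L x \<in> S" "k_smooth_on k S f"
  shows "k_smooth_on k T (\<lambda>x. f (a + L x))"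
  using assms(4)
proof (induction k arbitrary: f)
  case 0
  have "continuous_on T (\<lambda>x. a + L x)"
    using assms(1) by (intro continuous_intros) (simp add: linear_continuous_on)
  then show ?case using 0 assms(3) by (auto intro!: continuous_on_compose2[of S f])
next
  case (Suc k)
  have *: "dir_deriv v (\<lambda>x. f (a + L x)) x = dir_deriv (L v) f (a + L x)" if "x \<in> T" for x v
    using Suc.prems that assms by (intro dir_deriv_affine) auto
  have "k_smooth_on k T (dir_deriv v (\<lambda>x. f (a + L x)))" for v
    by (subst k_smooth_on_cong_open[OF assms(2) *]) (use Suc in auto)
  then show ?case using Suc.prems assms by (auto intro!: dir_deriv_affine(2))
qed

lemma smooth_on_affine:
  "bounded_linear L \<Longrightarrow> open T \<Longrightarrow> (\<And>x. x \<in> T \<Longrightarrow> a + L x \<in> S) \<Longrightarrow> smooth_on S f \<Longrightarrow>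
    smooth_on T (\<lambda>x. f (a + L x))"
  by (metis smooth_on_def k_smooth_on_affine)

text \<open>Applying the mean value theorem twice writes the second difference over a parallelogram as
  a mixed second derivative at one of its points; the second difference is symmetric in the two
  directions, which is what makes mixed derivatives commute.\<close>

lemma second_difference_mean_value:
  fixes f :: "'a::real_normed_vector \<Rightarrow> real"
  assumes diff: "\<And>y. y \<in> S \<Longrightarrow> f differentiable (at y)"
    and diff2: "\<And>y. y \<in> S \<Longrightarrow> dir_deriv v f differentiable (at y)"
    and "s > 0"
    and box: "\<And>p q. 0 \<le> p \<Longrightarrow> p \<le> s \<Longrightarrow> 0 \<le> q \<Longrightarrow> q \<le> s \<Longrightarrow> x + p *\<^sub>R v + q *\<^sub>R w \<in> S"
  obtains p q where "0 \<le> p" "p \<le> s" "0 \<le> q" "q \<le> s"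
    "f (x + s *\<^sub>R v + s *\<^sub>R w) - f (x + s *\<^sub>R v) - f (x + s *\<^sub>R w) + f x
       = s * s * dir_deriv w (dir_deriv v f) (x + p *\<^sub>R v + q *\<^sub>R w)"
proof -
  have line: "((\<lambda>r. g (z + r *\<^sub>R u)) has_real_derivative dir_deriv u g (z + r *\<^sub>R u)) (at r)"
    if "g differentiable (at (z + r *\<^sub>R u))" for g :: "'a \<Rightarrow> real" and z u r
  proof -
    have "((\<lambda>r. z + r *\<^sub>R u) has_derivative (\<lambda>h. h *\<^sub>R u)) (at r)"
      by (auto intro!: derivative_eq_intros)
    from has_derivative_compose[OF this has_dir_deriv[OF that]]
    have "((\<lambda>r. g (z + r *\<^sub>R u)) has_derivative (\<lambda>h. dir_deriv (h *\<^sub>R u) g (z + r *\<^sub>R u))) (at r)" .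
    moreover have "dir_deriv (h *\<^sub>R u) g (z + r *\<^sub>R u) = dir_deriv u g (z + r *\<^sub>R u) * h" for h
      using linear_frechet_derivative[OF that] by (simp add: linear_scale)
    ultimately show ?thesis by (simp add: has_field_derivative_def)
  qed
  define \<phi> where "\<phi> r = f ((x + s *\<^sub>R w) + r *\<^sub>R v) - f (x + r *\<^sub>R v)" for r
  have "DERIV \<phi> r :> dir_deriv v f ((x + s *\<^sub>R w) + r *\<^sub>R v) - dir_deriv v f (x + r *\<^sub>R v)"
    if "0 \<le> r" "r \<le> s" for r
    unfolding \<phi>_def using box[of r 0] box[of r s] that \<open>s > 0\<close>
    by (intro DERIV_diff line diff) (auto simp: algebra_simps)
  from MVT2[OF \<open>s > 0\<close> this] obtain p where p: "0 < p" "p < s"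
    and 1: "\<phi> s - \<phi> 0 = s * (dir_deriv v f ((x + s *\<^sub>R w) + p *\<^sub>R v) - dir_deriv v f (x + p *\<^sub>R v))"
    by auto
  have "DERIV (\<lambda>q. dir_deriv v f ((x + p *\<^sub>R v) + q *\<^sub>R w)) q :>
      dir_deriv w (dir_deriv v f) ((x + p *\<^sub>R v) + q *\<^sub>R w)" if "0 \<le> q" "q \<le> s" for q
    using box[of p q] that p by (intro line diff2) auto
  from MVT2[OF \<open>s > 0\<close> this] obtain q where q: "0 < q" "q < s"
    and 2: "dir_deriv v f ((x + p *\<^sub>R v) + s *\<^sub>R w) - dir_deriv v f ((x + p *\<^sub>R v) + 0 *\<^sub>R w) =
      s * dir_deriv w (dir_deriv v f) ((x + p *\<^sub>R v) + q *\<^sub>R w)"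
    by auto
  show ?thesis
    using that[of p q] p q 1 2 by (simp add: \<phi>_def algebra_simps)
qed

lemma dir_deriv_commute_real:
  fixes f :: "'a::real_normed_vector \<Rightarrow> real"
  assumes "open S" "smooth_on S f" "x \<in> S"
  shows "dir_deriv v (dir_deriv w f) x = dir_deriv w (dir_deriv v f) x"
proof -
  have *: "\<bar>dir_deriv w (dir_deriv v f) x - dir_deriv v (dir_deriv w f) x\<bar> < 2 * e" if "e > 0" for e
  proof -
    have cont: "isCont (dir_deriv a (dir_deriv b f)) x" for a b
    proof -
      have "continuous_on S (dir_deriv a (dir_deriv b f))"
        by (intro smooth_on_continuous smooth_on_dir_deriv assms)
      with assms(1,3) show ?thesis using continuous_on_eq_continuous_at by blast
    qed
    have near_value: "\<exists>d>0. \<forall>y. dist y x < d \<longrightarrow> \<bar>g y - g x\<bar> < e"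
      if "isCont g x" for g :: "'a \<Rightarrow> real"
      using that \<open>e > 0\<close> unfolding continuous_at_eps_delta dist_real_def by simp
    from near_value[OF cont[where a = w and b = v]] obtain d1 where d1: "d1 > 0"
      "\<forall>y. dist y x < d1 \<longrightarrow>
        \<bar>dir_deriv w (dir_deriv v f) y - dir_deriv w (dir_deriv v f) x\<bar> < e"
      by blast
    from near_value[OF cont[where a = v and b = w]] obtain d2 where d2: "d2 > 0"
      "\<forall>y. dist y x < d2 \<longrightarrow>
        \<bar>dir_deriv v (dir_deriv w f) y - dir_deriv v (dir_deriv w f) x\<bar> < e"
      by blast
    obtain d3 where d3: "d3 > 0" "ball x d3 \<subseteq> S"
      using assms(1,3) openE by blast
    define d where "d = min d1 (min d2 d3)"
    have "d > 0" using d1 d2 d3 by (simp add: d_def)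
    define N where "N = norm v + norm w + 1"
    have N: "N > 0" unfolding N_def by (smt (verit) norm_ge_zero)
    \<comment> \<open>with this side length the parallelogram stays inside the ball of radius \<open>d\<close>\<close>
    define s where "s = d / (2 * N)"
    have "s > 0" using \<open>d > 0\<close> N by (simp add: s_def)
    have near: "dist (x + p *\<^sub>R v + q *\<^sub>R w) x < d" if "0 \<le> p" "p \<le> s" "0 \<le> q" "q \<le> s" for p q
    proof -
      have "norm (p *\<^sub>R v + q *\<^sub>R w) \<le> norm (p *\<^sub>R v) + norm (q *\<^sub>R w)" by (rule norm_triangle_ineq)
      also have "\<dots> \<le> s * norm v + s * norm w"
        using that by (auto intro!: add_mono mult_right_mono)
      also have "\<dots> \<le> s * N" using \<open>s > 0\<close> by (simp add: N_def algebra_simps)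
      also have "\<dots> = d / 2" using N by (simp add: s_def)
      finally show ?thesis using \<open>d > 0\<close> by (simp add: dist_norm add.assoc)
    qed
    have box: "x + p *\<^sub>R v + q *\<^sub>R w \<in> S" if "0 \<le> p" "p \<le> s" "0 \<le> q" "q \<le> s" for p q
      using near[OF that] d3 by (auto simp: d_def dist_commute)
    have diff: "f differentiable (at y)" "dir_deriv u f differentiable (at y)" if "y \<in> S" for y u
      using smooth_on_differentiable[OF _ that] smooth_on_dir_deriv[OF assms(2)] assms(2) by auto
    obtain p q where pq: "0 \<le> p" "p \<le> s" "0 \<le> q" "q \<le> s"
      "f (x + s *\<^sub>R v + s *\<^sub>R w) - f (x + s *\<^sub>R v) - f (x + s *\<^sub>R w) + f x
         = s * s * dir_deriv w (dir_deriv v f) (x + p *\<^sub>R v + q *\<^sub>R w)"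
      using second_difference_mean_value[OF diff(1) diff(2) \<open>s > 0\<close> box] by blast
    have box': "x + p *\<^sub>R w + q *\<^sub>R v \<in> S" if "0 \<le> p" "p \<le> s" "0 \<le> q" "q \<le> s" for p q
      using box[of q p] that by (simp add: algebra_simps)
    obtain p' q' where pq': "0 \<le> p'" "p' \<le> s" "0 \<le> q'" "q' \<le> s"
      "f (x + s *\<^sub>R w + s *\<^sub>R v) - f (x + s *\<^sub>R w) - f (x + s *\<^sub>R v) + f x
         = s * s * dir_deriv v (dir_deriv w f) (x + p' *\<^sub>R w + q' *\<^sub>R v)"
      using second_difference_mean_value[OF diff(1) diff(2) \<open>s > 0\<close> box'] by blast
    have "s * s * dir_deriv w (dir_deriv v f) (x + p *\<^sub>R v + q *\<^sub>R w)
        = s * s * dir_deriv v (dir_deriv w f) (x + q' *\<^sub>R v + p' *\<^sub>R w)"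
      using pq(5) pq'(5) by (simp add: algebra_simps)
    then have eq: "dir_deriv w (dir_deriv v f) (x + p *\<^sub>R v + q *\<^sub>R w)
        = dir_deriv v (dir_deriv w f) (x + q' *\<^sub>R v + p' *\<^sub>R w)"
      using \<open>s > 0\<close> by simp
    have "dist (x + p *\<^sub>R v + q *\<^sub>R w) x < d1" "dist (x + q' *\<^sub>R v + p' *\<^sub>R w) x < d2"
      using near[of p q] near[of q' p'] pq pq' by (auto simp: d_def)
    from d1(2)[rule_format, OF this(1)] d2(2)[rule_format, OF this(2)] eq show ?thesis by linarith
  qed
  show ?thesis
  proof (rule ccontr)
    assume "dir_deriv v (dir_deriv w f) x \<noteq> dir_deriv w (dir_deriv v f) x"
    then have "\<bar>dir_deriv w (dir_deriv v f) x - dir_deriv v (dir_deriv w f) x\<bar> / 2 > 0" by simp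
    from *[OF this] show False by simp
  qed
qed

lemma dir_deriv_linear:
  assumes "bounded_linear L" "f differentiable (at x)"
  shows "dir_deriv v (\<lambda>x. L (f x)) x = L (dir_deriv v f x)"
  using bounded_linear.has_derivative[OF assms(1) has_dir_deriv[OF assms(2)]]
    by (rule dir_deriv_eqI)

lemma dir_deriv_commute:
  fixes f :: "'a::real_normed_vector \<Rightarrow> complex"
  assumes "open S" "smooth_on S f" "x \<in> S"
  shows "dir_deriv v (dir_deriv w f) x = dir_deriv w (dir_deriv v f) x"
proof -
  have "L (dir_deriv v (dir_deriv w f) x) = L (dir_deriv w (dir_deriv v f) x)"
    if L: "bounded_linear L" for L :: "complex \<Rightarrow> real"
  proof -
    have eq: "L (dir_deriv a (dir_deriv b f) x) = dir_deriv a (dir_deriv b (\<lambda>x. L (f x))) x" for a b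
    proof -
      have "L (dir_deriv a (dir_deriv b f) x) = dir_deriv a (\<lambda>x. L (dir_deriv b f x)) x"
        by (rule dir_deriv_linear[OF L, symmetric])
          (rule smooth_on_differentiable[OF smooth_on_dir_deriv[OF assms(2)] assms(3)])
      also have "\<dots> = dir_deriv a (dir_deriv b (\<lambda>x. L (f x))) x"
        by (rule dir_deriv_cong_open[OF assms(1,3)])
          (rule dir_deriv_linear[OF L smooth_on_differentiable[OF assms(2)], symmetric])
      finally show ?thesis .
    qed
    show ?thesis
      using dir_deriv_commute_real[OF assms(1) smooth_on_linear[OF L assms(1,2)] assms(3)]
      by (simp add: eq)
  qed
  from this[OF bounded_linear_Re] this[OF bounded_linear_Im] show ?thesis
    by (simp add: complex_eq_iff)
qed

section \<open>Calculus of Wirtinger derivatives\<close>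

abbreviation smooth :: "(complex \<Rightarrow> complex) \<Rightarrow> bool" where
  "smooth \<equiv> smooth_on UNIV"

lemma smooth_const [simp]: "smooth (\<lambda>p. c)"
  by (rule smooth_on_const)

lemma smooth_add [simp]: "smooth f \<Longrightarrow> smooth g \<Longrightarrow> smooth (\<lambda>p. f p + g p)"
  by (rule smooth_on_add) simp_all

lemma smooth_mult [simp]: "smooth f \<Longrightarrow> smooth g \<Longrightarrow> smooth (\<lambda>p. f p * g p)"
  by (rule smooth_on_bilinear[OF bounded_bilinear_mult]) simp_all

lemma smooth_uminus [simp]: "smooth f \<Longrightarrow> smooth (\<lambda>p. - f p)"
  using smooth_mult[of "\<lambda>p. - 1" f] by simp

lemma smooth_diff [simp]: "smooth f \<Longrightarrow> smooth g \<Longrightarrow> smooth (\<lambda>p. f p - g p)"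
  using smooth_add[of f "\<lambda>p. - g p"] by simp

lemma smooth_divide [simp]: "smooth f \<Longrightarrow> smooth (\<lambda>p. f p / c)"
  using smooth_mult[of f "\<lambda>p. inverse c"] by (simp add: divide_inverse)

lemma smooth_cnj [simp]: "smooth f \<Longrightarrow> smooth (\<lambda>p. cnj (f p))"
  by (rule smooth_on_linear[OF bounded_linear_cnj]) simp_all

lemma smooth_sum [simp]: "(\<And>i. i \<in> I \<Longrightarrow> smooth (f i)) \<Longrightarrow> smooth (\<lambda>p. \<Sum>i\<in>I. f i p)"
  by (induction I rule: infinite_finite_induct) simp_all

lemma smooth_dz [simp]: "smooth f \<Longrightarrow> smooth (dz f)"
  unfolding dz_def [abs_def] by (simp add: smooth_on_dir_deriv)

lemma smooth_dzbar [simp]: "smooth f \<Longrightarrow> smooth (dzbar f)"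
  unfolding dzbar_def [abs_def] by (simp add: smooth_on_dir_deriv)

lemma smooth_has_derivative:
  "smooth f \<Longrightarrow> (f has_derivative (\<lambda>v. dir_deriv v f p)) (at p)"
  by (simp add: has_dir_deriv smooth_on_differentiable)

lemma dz_const [simp]: "dz (\<lambda>p. c) = (\<lambda>p. 0)" and dzbar_const [simp]: "dzbar (\<lambda>p. c) = (\<lambda>p. 0)"
  by (simp_all add: dz_def dzbar_def fun_eq_iff)

lemma dz_add [simp]: "dz (\<lambda>p. f p + g p) = (\<lambda>p. dz f p + dz g p)" (is ?A)
  and dzbar_add [simp]: "dzbar (\<lambda>p. f p + g p) = (\<lambda>p. dzbar f p + dzbar g p)" (is ?B)
  if "smooth f" "smooth g"
proof -
  have "dir_deriv v (\<lambda>p. f p + g p) p = dir_deriv v f p + dir_deriv v g p" for v p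
    using that by (intro dir_deriv_eqI has_derivative_add smooth_has_derivative)
  then show ?A ?B by (simp_all add: dz_def dzbar_def fun_eq_iff field_simps)
qed

lemma dz_mult [simp]: "dz (\<lambda>p. f p * g p) = (\<lambda>p. dz f p * g p + f p * dz g p)" (is ?A)
  and dzbar_mult [simp]: "dzbar (\<lambda>p. f p * g p) = (\<lambda>p. dzbar f p * g p + f p * dzbar g p)" (is ?B)
  if "smooth f" "smooth g"
proof -
  have "dir_deriv v (\<lambda>p. f p * g p) p = f p * dir_deriv v g p + dir_deriv v f p * g p" for v p
    using that by (intro dir_deriv_eqI has_derivative_mult smooth_has_derivative)
  then show ?A ?B by (simp_all add: dz_def dzbar_def fun_eq_iff field_simps)
qed

lemma dz_uminus [simp]: "smooth f \<Longrightarrow> dz (\<lambda>p. - f p) = (\<lambda>p. - dz f p)"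
  and dzbar_uminus [simp]: "smooth f \<Longrightarrow> dzbar (\<lambda>p. - f p) = (\<lambda>p. - dzbar f p)"
  using dz_mult[of "\<lambda>p. - 1" f] dzbar_mult[of "\<lambda>p. - 1" f] by simp_all

lemma dz_diff [simp]: "smooth f \<Longrightarrow> smooth g \<Longrightarrow> dz (\<lambda>p. f p - g p) = (\<lambda>p. dz f p - dz g p)"
  and dzbar_diff [simp]:
    "smooth f \<Longrightarrow> smooth g \<Longrightarrow> dzbar (\<lambda>p. f p - g p) = (\<lambda>p. dzbar f p - dzbar g p)"
  using dz_add[of f "\<lambda>p. - g p"] dzbar_add[of f "\<lambda>p. - g p"] by simp_all

lemma dz_divide [simp]: "smooth f \<Longrightarrow> dz (\<lambda>p. f p / c) = (\<lambda>p. dz f p / c)"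
  and dzbar_divide [simp]: "smooth f \<Longrightarrow> dzbar (\<lambda>p. f p / c) = (\<lambda>p. dzbar f p / c)"
  using dz_mult[of f "\<lambda>p. inverse c"] dzbar_mult[of f "\<lambda>p. inverse c"]
  by (simp_all add: divide_inverse)

lemma dz_sum [simp]:
  "(\<And>i. i \<in> I \<Longrightarrow> smooth (f i)) \<Longrightarrow> dz (\<lambda>p. \<Sum>i\<in>I. f i p) = (\<lambda>p. \<Sum>i\<in>I. dz (f i) p)"
  by (induction I rule: infinite_finite_induct) simp_all

lemma dzbar_sum [simp]:
  "(\<And>i. i \<in> I \<Longrightarrow> smooth (f i)) \<Longrightarrow> dzbar (\<lambda>p. \<Sum>i\<in>I. f i p) = (\<lambda>p. \<Sum>i\<in>I. dzbar (f i) p)"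
  by (induction I rule: infinite_finite_induct) simp_all

lemma dz_cnj [simp]: "dz (\<lambda>p. cnj (f p)) = (\<lambda>p. cnj (dzbar f p))" (is ?A)
  and dzbar_cnj [simp]: "dzbar (\<lambda>p. cnj (f p)) = (\<lambda>p. cnj (dz f p))" (is ?B)
  if "smooth f"
proof -
  have "dir_deriv v (\<lambda>p. cnj (f p)) p = cnj (dir_deriv v f p)" for v p
    by (rule dir_deriv_linear[OF bounded_linear_cnj])
      (rule smooth_on_differentiable[OF that UNIV_I])
  then show ?A ?B by (simp_all add: dz_def dzbar_def fun_eq_iff)
qed

text \<open>Oriented as a rewrite rule, this puts every iterated derivative into the normal form with
  all \<open>dz\<close> outside.\<close>

lemma dzbar_dz [simp]: "dzbar (dz f) = dz (dzbar f)" if f: "smooth f"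
proof
  fix p
  have s: "smooth (dir_deriv v f)" for v using f by (rule smooth_on_dir_deriv)
  have c: "dir_deriv v (\<lambda>p. dir_deriv 1 f p + a * dir_deriv \<i> f p) p
      = dir_deriv v (dir_deriv 1 f) p + a * dir_deriv v (dir_deriv \<i> f) p" for v a
    by (intro dir_deriv_eqI has_derivative_add has_derivative_mult_right smooth_has_derivative s)
  have d: "dir_deriv v (\<lambda>p. g p / 2) p = dir_deriv v g p / 2" if "smooth g" for g v
    by (rule dir_deriv_linear[OF bounded_linear_divide])
      (rule smooth_on_differentiable[OF that UNIV_I])
  have 1: "dir_deriv v (dz f) p
      = (dir_deriv v (dir_deriv 1 f) p - \<i> * dir_deriv v (dir_deriv \<i> f) p) / 2" for v
    using c[where v = v and a = "- \<i>"]
      d[where g = "\<lambda>p. dir_deriv 1 f p - \<i> * dir_deriv \<i> f p" and v = v] s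
    by (simp add: dz_def [abs_def])
  have 2: "dir_deriv v (dzbar f) p
      = (dir_deriv v (dir_deriv 1 f) p + \<i> * dir_deriv v (dir_deriv \<i> f) p) / 2" for v
    using c[where v = v and a = "\<i>"]
      d[where g = "\<lambda>p. dir_deriv 1 f p + \<i> * dir_deriv \<i> f p" and v = v] s
    by (simp add: dzbar_def [abs_def])
  have comm: "dir_deriv 1 (dir_deriv \<i> f) p = dir_deriv \<i> (dir_deriv 1 f) p"
    using f by (rule dir_deriv_commute[OF open_UNIV _ UNIV_I])
  have "dzbar (dz f) p = (dir_deriv 1 (dir_deriv 1 f) p + dir_deriv \<i> (dir_deriv \<i> f) p) / 4"
    unfolding dzbar_def[of "dz f"] 1 by (simp add: field_simps comm)
  moreover have "dz (dzbar f) p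
      = (dir_deriv 1 (dir_deriv 1 f) p + dir_deriv \<i> (dir_deriv \<i> f) p) / 4"
    unfolding dz_def[of "dzbar f"] 2 by (simp add: field_simps comm)
  ultimately show "dzbar (dz f) p = dz (dzbar f) p" by (simp only:)
qed

text \<open>Componentwise, because the Wirtinger derivatives of vector-valued maps are defined
  componentwise.\<close>

definition vsmooth :: "(complex \<Rightarrow> complex ^ 'k) \<Rightarrow> bool" where
  "vsmooth g \<longleftrightarrow> (\<forall>i. smooth (\<lambda>p. g p $ i))"

lemma smooth_component [simp]: "vsmooth g \<Longrightarrow> smooth (\<lambda>p. g p $ i)"
  by (simp add: vsmooth_def)

lemma dz_vec_nth [simp]: "dz_vec g p $ i = dz (\<lambda>q. g q $ i) p"
  and dzbar_vec_nth [simp]: "dzbar_vec g p $ i = dzbar (\<lambda>q. g q $ i) p"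
  and cnj_vec_nth [simp]: "cnj_vec v $ i = cnj (v $ i)"
  and cvec_nth: "cvec w $ i = complex_of_real (w $ i)"
  by (simp_all add: dz_vec_def dzbar_vec_def cnj_vec_def cvec_def)

lemma vsmooth_dz_vec [simp]: "vsmooth g \<Longrightarrow> vsmooth (dz_vec g)"
  and vsmooth_dzbar_vec [simp]: "vsmooth g \<Longrightarrow> vsmooth (dzbar_vec g)"
  and vsmooth_add [simp]: "vsmooth g \<Longrightarrow> vsmooth h \<Longrightarrow> vsmooth (\<lambda>p. g p + h p)"
  and vsmooth_diff [simp]: "vsmooth g \<Longrightarrow> vsmooth h \<Longrightarrow> vsmooth (\<lambda>p. g p - h p)"
  and vsmooth_scale [simp]: "smooth f \<Longrightarrow> vsmooth g \<Longrightarrow> vsmooth (\<lambda>p. f p *s g p)"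
  and vsmooth_cnj_vec [simp]: "vsmooth g \<Longrightarrow> vsmooth (\<lambda>p. cnj_vec (g p))"
  by (simp_all add: vsmooth_def)

lemma dz_vec_add [simp]: "vsmooth g \<Longrightarrow> vsmooth h \<Longrightarrow>
    dz_vec (\<lambda>p. g p + h p) = (\<lambda>p. dz_vec g p + dz_vec h p)"
  and dzbar_vec_add [simp]: "vsmooth g \<Longrightarrow> vsmooth h \<Longrightarrow>
      dzbar_vec (\<lambda>p. g p + h p) = (\<lambda>p. dzbar_vec g p + dzbar_vec h p)"
  and dz_vec_diff [simp]: "vsmooth g \<Longrightarrow> vsmooth h \<Longrightarrow>
      dz_vec (\<lambda>p. g p - h p) = (\<lambda>p. dz_vec g p - dz_vec h p)"
  and dzbar_vec_diff [simp]: "vsmooth g \<Longrightarrow> vsmooth h \<Longrightarrow>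
      dzbar_vec (\<lambda>p. g p - h p) = (\<lambda>p. dzbar_vec g p - dzbar_vec h p)"
  and dz_vec_scale [simp]: "smooth f \<Longrightarrow> vsmooth g \<Longrightarrow>
      dz_vec (\<lambda>p. f p *s g p) = (\<lambda>p. dz f p *s g p + f p *s dz_vec g p)"
  and dzbar_vec_scale [simp]: "smooth f \<Longrightarrow> vsmooth g \<Longrightarrow>
      dzbar_vec (\<lambda>p. f p *s g p) = (\<lambda>p. dzbar f p *s g p + f p *s dzbar_vec g p)"
  and dz_vec_cnj [simp]: "vsmooth g \<Longrightarrow> dz_vec (\<lambda>p. cnj_vec (g p)) = (\<lambda>p. cnj_vec (dzbar_vec g p))"
  and dzbar_vec_cnj [simp]: "vsmooth g \<Longrightarrow> dzbar_vec (\<lambda>p. cnj_vec (g p)) = (\<lambda>p. cnj_vec (dz_vec g p))"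
  and dzbar_dz_vec [simp]: "vsmooth g \<Longrightarrow> dzbar_vec (dz_vec g) = dz_vec (dzbar_vec g)"
  by (simp_all add: vec_eq_iff fun_eq_iff)

text \<open>Writing the Lorentz form as a single weighted sum lets the rules for sums handle it.\<close>

definition metric_sign :: "'m option \<Rightarrow> 'a::comm_ring_1" where
  "metric_sign i = (if i = None then - 1 else 1)"

lemma lorentz_sum: "lorentz v w = (\<Sum>i\<in>UNIV. metric_sign i * (v $ i * w $ i))"
  by (simp add: lorentz_def UNIV_option_conv sum.reindex metric_sign_def)

lemma lorentz_commute: "lorentz v w = lorentz w v"
  by (simp add: lorentz_def mult.commute)

lemma lorentz_add_left [simp]: "lorentz (u + v) w = lorentz u w + lorentz v w"
  and lorentz_add_right [simp]: "lorentz w (u + v) = lorentz w u + lorentz w v"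
  and lorentz_diff_left [simp]: "lorentz (u - v) w = lorentz u w - lorentz v w"
  and lorentz_diff_right [simp]: "lorentz w (u - v) = lorentz w u - lorentz w v"
  and lorentz_scale_left [simp]: "lorentz (a *s u) w = a * lorentz u w"
  and lorentz_scale_right [simp]: "lorentz w (a *s u) = a * lorentz w u"
  and lorentz_uminus_right [simp]: "lorentz w (- u) = - lorentz w u"
  by (simp_all add: lorentz_sum sum.distrib sum_subtractf sum_distrib_left sum_negf algebra_simps)

lemma lorentz_cnj: "lorentz (cnj_vec v) (cnj_vec w) = cnj (lorentz v w)"
  by (simp add: lorentz_def)

lemma lorentz_cvec: "lorentz (cvec v) (cvec w) = complex_of_real (lorentz v w)"
  by (simp add: lorentz_def cvec_nth)

lemma cnj_vec_simps [simp]: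
  "cnj_vec (u + v) = cnj_vec u + cnj_vec v" "cnj_vec (u - v) = cnj_vec u - cnj_vec v"
  "cnj_vec (a *s u) = cnj a *s cnj_vec u" "cnj_vec (cnj_vec u) = u" "cnj_vec (cvec w) = cvec w"
  by (simp_all add: vec_eq_iff cvec_nth)

lemma smooth_lorentz [simp]: "vsmooth g \<Longrightarrow> vsmooth h \<Longrightarrow> smooth (\<lambda>p. lorentz (g p) (h p))"
  by (simp add: lorentz_sum)

lemma dz_lorentz [simp]: "vsmooth g \<Longrightarrow> vsmooth h \<Longrightarrow>
    dz (\<lambda>p. lorentz (g p) (h p)) = (\<lambda>p. lorentz (dz_vec g p) (h p) + lorentz (g p) (dz_vec h p))"
  and dzbar_lorentz [simp]: "vsmooth g \<Longrightarrow> vsmooth h \<Longrightarrow>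
    dzbar (\<lambda>p. lorentz (g p) (h p))
        = (\<lambda>p. lorentz (dzbar_vec g p) (h p) + lorentz (g p) (dzbar_vec h p))"
  by (simp_all add: lorentz_sum sum.distrib[symmetric] algebra_simps)

section \<open>The frame of a conformal lift\<close>

lemma span4_iff:
  "v \<in> vec.span {w1, w2, w3, w4 :: complex ^ 'k} \<longleftrightarrow>
    (\<exists>a b c d. v = a *s w1 + b *s w2 + c *s w3 + d *s w4)"
proof -
  have "v \<in> vec.span {w1, w2, w3, w4} \<longleftrightarrow>
    (\<exists>a b c d. v - a *s w1 - b *s w2 - c *s w3 - d *s w4 = 0)"
    by (simp only: vec.span_breakdown_eq vec.span_empty singleton_iff)
  also have "\<dots> \<longleftrightarrow> (\<exists>a b c d. v = a *s w1 + b *s w2 + c *s w3 + d *s w4)"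
    by (simp add: algebra_simps)
  finally show ?thesis .
qed

text \<open>The only properties of a normalized lift that the structure equations use. In the names
  below, \<open>x\<close> is the complexified lift and \<open>w\<close> stands for the conjugate coordinate of \<open>z\<close>; thus
  \<open>xzw\<close> is the mixed second derivative.\<close>

locale conformal_lift =
  fixes \<psi> :: "complex \<Rightarrow> real ^ 'm::finite option"
  assumes smooth_lift: "smooth_on UNIV \<psi>"
    and null_lift: "\<And>p. lorentz (\<psi> p) (\<psi> p) = 0"
    and isometric_lift: "\<And>p v. lorentz (dir_deriv v \<psi> p) (dir_deriv v \<psi> p) = (norm v)\<^sup>2"
begin

abbreviation x where "x \<equiv> complexified \<psi>"
abbreviation xz where "xz \<equiv> dz_vec x"
abbreviation xw where "xw \<equiv> dzbar_vec x"
abbreviation xzw where "xzw \<equiv> dz_vec (dzbar_vec x)"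

lemma vsmooth_x [simp]: "vsmooth x"
proof -
  have "bounded_linear (\<lambda>v::real^'m option. complex_of_real (v $ i))" for i
    using bounded_linear_compose[OF bounded_linear_of_real bounded_linear_vec_nth] .
  from smooth_on_linear[OF this open_UNIV smooth_lift] show ?thesis
    by (simp add: vsmooth_def cvec_nth)
qed

lemma cnj_x [simp]: "cnj_vec (xz p) = xw p" "cnj_vec (xw p) = xz p" "cnj_vec (xzw p) = xzw p"
proof -
  have z: "cnj_vec (dz_vec g p) = dzbar_vec (\<lambda>p. cnj_vec (g p)) p"
      if "vsmooth g" for g :: "complex \<Rightarrow> complex ^ 'm option" and p
    using that by simp
  have w: "cnj_vec (dzbar_vec g p) = dz_vec (\<lambda>p. cnj_vec (g p)) p"
      if "vsmooth g" for g :: "complex \<Rightarrow> complex ^ 'm option" and p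
    using that by simp
  show 1: "cnj_vec (xz p) = xw p" and 2: "cnj_vec (xw p) = xz p" for p
    using z[of x] w[of x] by (simp_all del: dz_vec_cnj dzbar_vec_cnj)
  show "cnj_vec (xzw p) = xzw p"
    using z[of xw p] by (simp add: 2 del: dz_vec_cnj dzbar_vec_cnj)
qed

lemma xx [simp]: "lorentz (x p) (x p) = 0"
  by (simp add: lorentz_cvec null_lift)

lemma derivative_components:
  "dz (\<lambda>q. x q $ i) p
      = (complex_of_real (dir_deriv 1 \<psi> p $ i) - \<i> * complex_of_real (dir_deriv \<i> \<psi> p $ i)) / 2"
  "dzbar (\<lambda>q. x q $ i) p
      = (complex_of_real (dir_deriv 1 \<psi> p $ i) + \<i> * complex_of_real (dir_deriv \<i> \<psi> p $ i)) / 2"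
proof -
  have "bounded_linear (\<lambda>v::real^'m option. complex_of_real (v $ i))"
    using bounded_linear_compose[OF bounded_linear_of_real bounded_linear_vec_nth] .
  from dir_deriv_linear[OF this smooth_on_differentiable[OF smooth_lift UNIV_I]]
  have "dir_deriv v (\<lambda>q. x q $ i) p = complex_of_real (dir_deriv v \<psi> p $ i)" for v
    by (simp add: cvec_nth)
  then show "dz (\<lambda>q. x q $ i) p
      = (complex_of_real (dir_deriv 1 \<psi> p $ i) - \<i> * complex_of_real (dir_deriv \<i> \<psi> p $ i)) / 2"
    "dzbar (\<lambda>q. x q $ i) p
        = (complex_of_real (dir_deriv 1 \<psi> p $ i) + \<i> * complex_of_real (dir_deriv \<i> \<psi> p $ i)) / 2"
    unfolding dz_def dzbar_def by simp_all
qed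

lemma xz_xz [simp]: "lorentz (xz p) (xz p) = 0"
  and xz_xw [simp]: "lorentz (xz p) (xw p) = 1 / 2"
proof -
  define X where "X = dir_deriv 1 \<psi> p"
  define Y where "Y = dir_deriv \<i> \<psi> p"
  have lin: "linear (\<lambda>v. dir_deriv v \<psi> p)"
    using smooth_on_differentiable[OF smooth_lift UNIV_I] by (rule linear_frechet_derivative)
  have XX: "lorentz X X = 1" and YY: "lorentz Y Y = 1"
    using isometric_lift[where v = 1 and p = p] isometric_lift[where v = \<i> and p = p]
      by (simp_all add: X_def Y_def)
  have "lorentz (X + Y) (X + Y) = 2"
    using isometric_lift[where v = "1 + \<i>" and p = p] linear_add[OF lin, of 1 \<i>]
    by (simp add: X_def Y_def cmod_power2)
  then have XY: "lorentz X Y = 0" using XX YY lorentz_commute[of X Y] by simp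
  have z: "xz p = (1 / 2) *s (cvec X - \<i> *s cvec Y)"
    and w: "xw p = (1 / 2) *s (cvec X + \<i> *s cvec Y)"
    by (simp_all add: vec_eq_iff derivative_components cvec_nth[of "dir_deriv _ \<psi> p"] X_def Y_def)
  show "lorentz (xz p) (xz p) = 0" "lorentz (xz p) (xw p) = 1 / 2"
    unfolding z w using XX YY XY lorentz_commute[of X Y] by (simp_all add: lorentz_cvec)
qed

text \<open>All relations between the frame vectors come from differentiating a constant inner
  product, up to conjugation.\<close>

lemma diff_lorentz:
  assumes "\<And>p. lorentz (g p) (h p) = c" "vsmooth g" "vsmooth h"
  shows "lorentz (dz_vec g p) (h p) + lorentz (g p) (dz_vec h p) = 0"
    and "lorentz (dzbar_vec g p) (h p) + lorentz (g p) (dzbar_vec h p) = 0"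
proof -
  have "(\<lambda>p. lorentz (g p) (h p)) = (\<lambda>p. c)" using assms(1) by auto
  then have "dz (\<lambda>p. lorentz (g p) (h p)) p = 0" "dzbar (\<lambda>p. lorentz (g p) (h p)) p = 0" by simp_all
  then show "lorentz (dz_vec g p) (h p) + lorentz (g p) (dz_vec h p) = 0"
    "lorentz (dzbar_vec g p) (h p) + lorentz (g p) (dzbar_vec h p) = 0"
    using assms(2,3) by simp_all
qed

lemma xz_x [simp]: "lorentz (xz p) (x p) = 0" "lorentz (x p) (xz p) = 0"
  and xw_x [simp]: "lorentz (xw p) (x p) = 0" "lorentz (x p) (xw p) = 0"
  using diff_lorentz[of x x 0 p] by (simp_all add: lorentz_commute[of "x p"])

lemma xw_xz [simp]: "lorentz (xw p) (xz p) = 1 / 2"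
  by (simp add: lorentz_commute[of "xw p"])

lemma xw_xw [simp]: "lorentz (xw p) (xw p) = 0"
  using lorentz_cnj[of "xz p" "xz p"] by simp

lemma xzw_x [simp]: "lorentz (xzw p) (x p) = - 1 / 2" "lorentz (x p) (xzw p) = - 1 / 2"
proof -
  have "lorentz (xzw p) (x p) + 1 / 2 = 0" using diff_lorentz(1)[of xw x 0 p] by simp
  then show "lorentz (xzw p) (x p) = - 1 / 2" by (simp add: eq_neg_iff_add_eq_0)
  then show "lorentz (x p) (xzw p) = - 1 / 2" by (simp add: lorentz_commute[of "x p"])
qed

lemma xzw_xz [simp]: "lorentz (xzw p) (xz p) = 0" "lorentz (xz p) (xzw p) = 0"
  using diff_lorentz(2)[of xz xz 0 p] by (simp_all add: lorentz_commute[of "xz p"])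

lemma xzw_xw [simp]: "lorentz (xzw p) (xw p) = 0" "lorentz (xw p) (xzw p) = 0"
  using lorentz_cnj[of "xzw p" "xz p"] lorentz_cnj[of "xz p" "xzw p"] by simp_all

lemma xzz_x [simp]: "lorentz (dz_vec xz p) (x p) = 0" "lorentz (x p) (dz_vec xz p) = 0"
  using diff_lorentz(1)[of xz x 0 p] by (simp_all add: lorentz_commute[of "x p"])

lemma xzz_xz [simp]: "lorentz (dz_vec xz p) (xz p) = 0" "lorentz (xz p) (dz_vec xz p) = 0"
  using diff_lorentz(1)[of xz xz 0 p] by (simp_all add: lorentz_commute[of "xz p"])

lemma xzz_xw [simp]: "lorentz (dz_vec xz p) (xw p) = 0" "lorentz (xw p) (dz_vec xz p) = 0"
  using diff_lorentz(1)[of xz xw "1/2" p] by (simp_all add: lorentz_commute[of "xw p"])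

lemma V_fibre_iff: "v \<in> V_fibre \<psi> p \<longleftrightarrow>
    (\<exists>a b c d. v = a *s x p + b *s xz p + c *s xw p + d *s xzw p)"
  by (simp add: V_fibre_def span4_iff)

lemma normal_fibre_iff: "w \<in> normal_fibre \<psi> p \<longleftrightarrow>
    lorentz (x p) w = 0 \<and> lorentz (xz p) w = 0 \<and> lorentz (xw p) w = 0 \<and> lorentz (xzw p) w = 0"
    (is "_ \<longleftrightarrow> ?R")
proof
  assume w: "w \<in> normal_fibre \<psi> p"
  have "x p \<in> V_fibre \<psi> p" "xz p \<in> V_fibre \<psi> p" "xw p \<in> V_fibre \<psi> p" "xzw p \<in> V_fibre \<psi> p"
    by (auto simp: V_fibre_def vec.span_base)
  with w show ?R by (auto simp: normal_fibre_def)
next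
  assume ?R
  then show "w \<in> normal_fibre \<psi> p"
    by (auto simp: normal_fibre_def V_fibre_iff)
qed

lemma V_fibre_diff: "u \<in> V_fibre \<psi> p \<Longrightarrow> v \<in> V_fibre \<psi> p \<Longrightarrow> u - v \<in> V_fibre \<psi> p"
  and V_fibre_add: "u \<in> V_fibre \<psi> p \<Longrightarrow> v \<in> V_fibre \<psi> p \<Longrightarrow> u + v \<in> V_fibre \<psi> p"
  by (simp_all add: V_fibre_def vec.span_diff vec.span_add)

lemma x_in_V: "x p \<in> V_fibre \<psi> p" "xz p \<in> V_fibre \<psi> p" "xw p \<in> V_fibre \<psi> p" "xzw p \<in> V_fibre \<psi> p"
  by (auto simp: V_fibre_def vec.span_base)

lemma V_fibre_scale: "v \<in> V_fibre \<psi> p \<Longrightarrow> a *s v \<in> V_fibre \<psi> p"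
  by (simp add: V_fibre_def vec.span_scale)

lemmas V_intros = x_in_V V_fibre_scale V_fibre_add V_fibre_diff

lemma normal_fibre_diff: "u \<in> normal_fibre \<psi> p \<Longrightarrow> v \<in> normal_fibre \<psi> p \<Longrightarrow> u - v \<in> normal_fibre \<psi> p"
  by (simp add: normal_fibre_iff)

lemma V_fibre_cnj: assumes "v \<in> V_fibre \<psi> p" shows "cnj_vec v \<in> V_fibre \<psi> p"
proof -
  obtain a b c d where "v = a *s x p + b *s xz p + c *s xw p + d *s xzw p"
    using assms V_fibre_iff by blast
  then have "cnj_vec v = cnj a *s x p + cnj c *s xz p + cnj b *s xw p + cnj d *s xzw p"
    by simp
  then show ?thesis using V_fibre_iff by blast
qed

lemma normal_fibre_cnj: assumes "v \<in> normal_fibre \<psi> p" shows "cnj_vec v \<in> normal_fibre \<psi> p"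
  unfolding normal_fibre_def
proof (intro CollectI ballI)
  fix u assume "u \<in> V_fibre \<psi> p"
  then have "lorentz (cnj_vec u) v = 0" using V_fibre_cnj assms by (auto simp: normal_fibre_def)
  then show "lorentz u (cnj_vec v) = 0" using lorentz_cnj[of "cnj_vec u" v] by simp
qed

text \<open>The Gram matrix of the frame \<open>x, xz, xw, xzw\<close> is nondegenerate: \<open>x\<close> pairs only with \<open>xzw\<close>
  and \<open>xz\<close> only with \<open>xw\<close>, except for \<open>\<langle>xzw, xzw\<rangle>\<close>, which is harmless once the coefficient of
  \<open>xzw\<close> is known to vanish.\<close>

lemma V_inter_normal:
  assumes "v \<in> V_fibre \<psi> p" "v \<in> normal_fibre \<psi> p"
  shows "v = 0"
proof -
  obtain a b c d where v: "v = a *s x p + b *s xz p + c *s xw p + d *s xzw p"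
    using assms V_fibre_iff by blast
  have "d = 0" "b = 0" "c = 0"
    using assms(2) unfolding normal_fibre_iff by (auto simp: v)
  moreover from this have "a = 0"
    using assms(2) unfolding normal_fibre_iff by (auto simp: v)
  ultimately show ?thesis by (simp add: v)
qed

lemma normal_proj_eqI:
  assumes "w \<in> normal_fibre \<psi> p" "v - w \<in> V_fibre \<psi> p"
  shows "normal_proj \<psi> p v = w"
  unfolding normal_proj_def
proof (rule the_equality)
  fix w' assume w': "w' \<in> normal_fibre \<psi> p \<and> v - w' \<in> V_fibre \<psi> p"
  have "w' - w \<in> V_fibre \<psi> p" using V_fibre_diff[OF assms(2), of "v - w'"] w' by simp
  moreover have "w' - w \<in> normal_fibre \<psi> p" using w' assms normal_fibre_diff by blast
  ultimately show "w' = w" using V_inter_normal by fastforce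
qed (use assms in simp)

lemma normal_proj_exists: "\<exists>w. w \<in> normal_fibre \<psi> p \<and> v - w \<in> V_fibre \<psi> p"
proof -
  define m where "m = lorentz (xzw p) (xzw p)"
  \<comment> \<open>the tangential part of \<open>v\<close>, obtained by inverting the Gram matrix of the frame\<close>
  define u where "u = (- 2 * lorentz v (xzw p) - 4 * m * lorentz v (x p)) *s x p
    + (2 * lorentz v (xw p)) *s xz p + (2 * lorentz v (xz p)) *s xw p
    + (- 2 * lorentz v (x p)) *s xzw p"
  have "u \<in> V_fibre \<psi> p" unfolding V_fibre_iff u_def by blast
  then have "v - (v - u) \<in> V_fibre \<psi> p" by simp
  moreover have "v - u \<in> normal_fibre \<psi> p"
    unfolding normal_fibre_iff
    by (simp add: u_def m_def[symmetric] lorentz_commute[of _ v])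
  ultimately show ?thesis by blast
qed

text \<open>\<open>V\<close> is the complexification of a real bundle, so the normal projection commutes with
  conjugation.\<close>

lemma normal_proj_real:
  assumes "v - cnj_vec v \<in> V_fibre \<psi> p"
  shows "Im_vec (normal_proj \<psi> p v) = 0"
proof -
  obtain w where w: "w \<in> normal_fibre \<psi> p" "v - w \<in> V_fibre \<psi> p"
    using normal_proj_exists by blast
  have "(v - cnj_vec v) + cnj_vec (v - w) \<in> V_fibre \<psi> p"
    using assms V_fibre_add V_fibre_cnj w by blast
  then have "normal_proj \<psi> p v = cnj_vec w"
    by (intro normal_proj_eqI normal_fibre_cnj w) simp
  moreover have "normal_proj \<psi> p v = w" using w by (rule normal_proj_eqI)
  ultimately have "w = cnj_vec w" by simp
  then have "Im (w $ i) = 0" for i by (metis cnj_vec_nth Reals_cnj_iff complex_is_Real_iff)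
  then show ?thesis using \<open>normal_proj \<psi> p v = w\<close> by (simp add: Im_vec_def vec_eq_iff)
qed

text \<open>All pairings of \<open>x\<^sub>z\<^sub>z\<close> with the frame vanish except the one with \<open>xzw\<close>, which therefore
  determines the Schwarzian.\<close>

lemma schwarzian_eq: "schwarzian \<psi> p = 4 * lorentz (dz_vec xz p) (xzw p)"
  unfolding schwarzian_def
  by (rule the_equality)
    (auto simp: normal_fibre_iff lorentz_commute[of "xzw p"] field_simps)

definition c where "c = schwarzian \<psi>"
definition \<kappa> where "\<kappa> = hopf \<psi>"

lemma \<kappa>_eq: "\<kappa> = (\<lambda>p. dz_vec xz p + (c p / 2) *s x p)"
  by (simp add: \<kappa>_def hopf_def fun_eq_iff c_def)

lemma c_eq: "c = (\<lambda>p. 4 * lorentz (dz_vec xz p) (xzw p))"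
  by (simp add: c_def schwarzian_eq fun_eq_iff)

lemma smooth_c [simp]: "smooth c" by (simp add: c_eq)

lemma vsmooth_\<kappa> [simp]: "vsmooth \<kappa>" by (simp add: \<kappa>_eq)

lemma \<kappa>_normal: "\<kappa> p \<in> normal_fibre \<psi> p"
  unfolding normal_fibre_iff \<kappa>_eq by (simp add: c_eq lorentz_commute[of "xzw p"])

lemma \<kappa>_orth [simp]:
  "lorentz (\<kappa> p) (x p) = 0" "lorentz (\<kappa> p) (xz p) = 0"
  "lorentz (\<kappa> p) (xw p) = 0" "lorentz (\<kappa> p) (xzw p) = 0"
  "lorentz (x p) (\<kappa> p) = 0" "lorentz (xz p) (\<kappa> p) = 0"
  "lorentz (xw p) (\<kappa> p) = 0" "lorentz (xzw p) (\<kappa> p) = 0"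
  using \<kappa>_normal[of p] by (simp_all add: normal_fibre_iff lorentz_commute[of "\<kappa> p"])

lemma xzz: "dz_vec xz = (\<lambda>p. \<kappa> p - (c p / 2) *s x p)"
  by (simp add: \<kappa>_eq)

end

section \<open>Structure equations of isothermic surfaces\<close>

text \<open>Isothermicity makes \<open>\<kappa>\<close> real, so that both pure second derivatives of \<open>x\<close> are expressed by
  the same normal vector \<open>\<kappa>\<close> (\<open>xzz\<close>, \<open>xww\<close>).\<close>

locale isothermic_lift = conformal_lift +
  assumes isothermic: "isothermic \<psi>"
begin

lemma cnj_\<kappa> [simp]: "cnj_vec (\<kappa> p) = \<kappa> p"
  using isothermic by (simp add: \<kappa>_def isothermic_def)

lemma cnj_dz_\<kappa> [simp]: "cnj_vec (dz_vec \<kappa> p) = dzbar_vec \<kappa> p" "cnj_vec (dzbar_vec \<kappa> p) = dz_vec \<kappa> p"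
  using dzbar_vec_cnj[of \<kappa>] dz_vec_cnj[of \<kappa>] by (simp_all add: fun_eq_iff)

lemma xww: "dzbar_vec xw = (\<lambda>p. \<kappa> p - (cnj (c p) / 2) *s x p)"
proof
  fix p
  have "dzbar_vec xw p = dzbar_vec (\<lambda>p. cnj_vec (xz p)) p" by simp
  also have "\<dots> = cnj_vec (dz_vec xz p)" by (subst dzbar_vec_cnj) simp_all
  also have "\<dots> = \<kappa> p - (cnj (c p) / 2) *s x p" by (simp add: xzz)
  finally show "dzbar_vec xw p = \<kappa> p - (cnj (c p) / 2) *s x p" .
qed

lemma dz_xzw: "dz_vec xzw = (\<lambda>p. dzbar_vec \<kappa> p - (dzbar c p / 2) *s x p - (c p / 2) *s xw p)"
proof -
  have "dz_vec xzw = dzbar_vec (dz_vec xz)" by simp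
  also have "\<dots> = (\<lambda>p. dzbar_vec \<kappa> p - (dzbar c p / 2) *s x p - (c p / 2) *s xw p)"
    by (subst xzz) (simp add: diff_diff_eq)
  finally show ?thesis .
qed

definition h where "h = (\<lambda>p. lorentz (\<kappa> p) (\<kappa> p))"

lemma smooth_h [simp]: "smooth h" by (simp add: h_def)

lemma \<kappa>_\<kappa>: "lorentz (\<kappa> p) (\<kappa> p) = h p" by (simp add: h_def)

lemma cnj_h [simp]: "cnj (h p) = h p"
  using lorentz_cnj[of "\<kappa> p" "\<kappa> p"] by (simp add: h_def)

lemma cnj_dz_h [simp]: "cnj (dz h p) = dzbar h p" "cnj (dzbar h p) = dz h p"
  using dzbar_cnj[of h] dz_cnj[of h] by (simp_all add: fun_eq_iff)

lemma dz_h: "lorentz (dz_vec \<kappa> p) (\<kappa> p) = dz h p / 2" "lorentz (\<kappa> p) (dz_vec \<kappa> p) = dz h p / 2"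
  and dzbar_h: "lorentz (dzbar_vec \<kappa> p) (\<kappa> p) = dzbar h p / 2"
    "lorentz (\<kappa> p) (dzbar_vec \<kappa> p) = dzbar h p / 2"
  by (simp_all add: h_def lorentz_commute[of "\<kappa> p"])

lemma \<kappa>z_orth:
  "lorentz (dz_vec \<kappa> p) (x p) = 0" "lorentz (dz_vec \<kappa> p) (xz p) = - h p"
  "lorentz (dz_vec \<kappa> p) (xw p) = 0" "lorentz (dz_vec \<kappa> p) (xzw p) = - dzbar h p / 2"
  using diff_lorentz(1)[of \<kappa> x 0 p] diff_lorentz(1)[of \<kappa> xz 0 p] diff_lorentz(1)[of \<kappa> xw 0 p]
    diff_lorentz(1)[of \<kappa> xzw 0 p] dzbar_h
  by (simp_all add: xzz dz_xzw \<kappa>_\<kappa> add_eq_0_iff2)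

lemma \<kappa>w_orth:
  "lorentz (dzbar_vec \<kappa> p) (x p) = 0" "lorentz (dzbar_vec \<kappa> p) (xw p) = - h p"
  "lorentz (dzbar_vec \<kappa> p) (xz p) = 0" "lorentz (dzbar_vec \<kappa> p) (xzw p) = - dz h p / 2"
  using \<kappa>z_orth[of p] lorentz_cnj[of "dz_vec \<kappa> p" "x p"] lorentz_cnj[of "dz_vec \<kappa> p" "xz p"]
    lorentz_cnj[of "dz_vec \<kappa> p" "xw p"] lorentz_cnj[of "dz_vec \<kappa> p" "xzw p"]
  by simp_all

lemma xzw_xzw: "lorentz (xzw p) (xzw p) = h p"
  using diff_lorentz(1)[of xzw xw 0 p] \<kappa>w_orth[of p] by (simp add: dz_xzw)

text \<open>The Gauss equation. The derivative of \<open>h = \<langle>xzw, xzw\<rangle>\<close> is computed once more from the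
  formula for the derivative of \<open>xzw\<close>; the derivative of \<open>\<kappa>\<close> contributes \<open>- dz h\<close>, which is
  moved to the other side.\<close>

lemma dzbar_c: "dzbar c = (\<lambda>p. 4 * dz h p)"
proof
  fix p
  have "(\<lambda>p. lorentz (xzw p) (xzw p)) = h" by (simp add: xzw_xzw)
  then have "dz h p = dz (\<lambda>p. lorentz (xzw p) (xzw p)) p" by simp
  also have "\<dots> = 2 * lorentz (dz_vec xzw p) (xzw p)" by (simp add: lorentz_commute[of "xzw p"])
  also have "\<dots> = - dz h p + dzbar c p / 2"
    using \<kappa>w_orth[of p] by (simp add: dz_xzw algebra_simps)
  finally show "dzbar c p = 4 * dz h p" by (simp add: field_simps)
qed

lemma dz_cnj_c: "dz (\<lambda>p. cnj (c p)) = (\<lambda>p. 4 * dzbar h p)"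
  by (simp add: dzbar_c)

text \<open>Differentiating the orthogonality relations of \<open>\<kappa>\<close> gives the tangential part of its
  derivative (\<open>\<kappa>z_orth\<close>); subtracting it leaves the covariant derivative.\<close>

lemma D_z_hopf: "D_z \<psi> (hopf \<psi>) p = dz_vec \<kappa> p + (2 * h p) *s xw p - dzbar h p *s x p"
  unfolding D_z_def \<kappa>_def[symmetric]
proof (rule normal_proj_eqI)
  show "dz_vec \<kappa> p + (2 * h p) *s xw p - dzbar h p *s x p \<in> normal_fibre \<psi> p"
    using \<kappa>z_orth[of p] by (simp add: normal_fibre_iff lorentz_commute[of _ "dz_vec \<kappa> p"])
  have "dzbar h p *s x p - (2 * h p) *s xw p \<in> V_fibre \<psi> p" by (intro V_intros)
  then show "dz_vec \<kappa> p - (dz_vec \<kappa> p + (2 * h p) *s xw p - dzbar h p *s x p) \<in> V_fibre \<psi> p" by simp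
qed

lemma D_zbar_hopf:
    "D_zbar \<psi> (\<lambda>q. cnj_vec (hopf \<psi> q)) p = dzbar_vec \<kappa> p + (2 * h p) *s xz p - dz h p *s x p"
  unfolding D_zbar_def \<kappa>_def[symmetric] cnj_\<kappa>
proof (rule normal_proj_eqI)
  show "dzbar_vec \<kappa> p + (2 * h p) *s xz p - dz h p *s x p \<in> normal_fibre \<psi> p"
    using \<kappa>w_orth[of p] by (simp add: normal_fibre_iff lorentz_commute[of _ "dzbar_vec \<kappa> p"])
  have "dz h p *s x p - (2 * h p) *s xz p \<in> V_fibre \<psi> p" by (intro V_intros)
  then show "dzbar_vec \<kappa> p - (dzbar_vec \<kappa> p
      + (2 * h p) *s xz p - dz h p *s x p) \<in> V_fibre \<psi> p" by simp
qed

definition \<sigma> where "\<sigma> = (\<lambda>p. 2 *s Re_Dz_hopf \<psi> p)"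

lemma \<sigma>_eq: "\<sigma> = (\<lambda>p. dz_vec \<kappa> p + dzbar_vec \<kappa> p + (2 * h p) *s xz p + (2 * h p) *s xw p
    - (dz h p + dzbar h p) *s x p)"
  by (simp add: \<sigma>_def Re_Dz_hopf_def D_z_hopf D_zbar_hopf fun_eq_iff vec_eq_iff algebra_simps)

text \<open>Both sides equal \<open>dz h + dzbar h\<close>: on the left by the Gauss equation, on the right because
  only the derivatives of \<open>\<kappa>\<close> in \<open>\<sigma>\<close> pair nontrivially with \<open>\<kappa>\<close>.\<close>

lemma explicit_b:
  "dz (\<lambda>q. cnj (h q + c q / 4)) p = 2 * lorentz (\<sigma> p) (\<kappa> p)"
  by (simp add: \<sigma>_eq dz_h dzbar_h dzbar_c algebra_simps)

text \<open>Subtracting the two equations \<open>xzz\<close> and \<open>xww\<close> eliminates \<open>\<kappa>\<close> and leaves \<open>L x = 0\<close>.\<close>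

definition e where "e = (\<lambda>p. (c p - cnj (c p)) / 2)"

definition L where "L g p = dz_vec (dz_vec g) p - dzbar_vec (dzbar_vec g) p + e p *s g p"

lemma smooth_e [simp]: "smooth e" by (simp add: e_def)

lemma L_add: "vsmooth f \<Longrightarrow> vsmooth g \<Longrightarrow> L (\<lambda>p. f p + g p) p = L f p + L g p"
  by (simp add: L_def vec_eq_iff algebra_simps)

text \<open>\<open>L\<close> has constant coefficients apart from \<open>e\<close>, hence commutes with derivatives up to the
  derivative of \<open>e\<close>.\<close>

lemma L_dz: "vsmooth g \<Longrightarrow> L (dz_vec g) p = dz_vec (L g) p - dz e p *s g p"
  unfolding L_def [abs_def] by (simp add: vec_eq_iff algebra_simps)

lemma L_dzbar: "vsmooth g \<Longrightarrow> L (dzbar_vec g) p = dzbar_vec (L g) p - dzbar e p *s g p"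
  unfolding L_def [abs_def] by (simp add: vec_eq_iff algebra_simps)

lemma L_scale: "smooth f \<Longrightarrow> vsmooth g \<Longrightarrow> L (\<lambda>p. f p *s g p) p =
    f p *s L g p + (2 * dz f p) *s dz_vec g p - (2 * dzbar f p) *s dzbar_vec g p
     + (dz (dz f) p - dzbar (dzbar f) p) *s g p"
  by (simp add: L_def vec_eq_iff algebra_simps)

lemma L_x: "L x = (\<lambda>p. 0)"
  unfolding L_def [abs_def] by (simp add: xzz xww e_def vec_eq_iff field_simps fun_eq_iff)

lemma dz_vec_zero [simp]: "dz_vec (\<lambda>p. 0) = (\<lambda>p. 0)" "dzbar_vec (\<lambda>p. 0) = (\<lambda>p. 0)"
  by (simp_all add: vec_eq_iff fun_eq_iff)

lemma L_xz: "L xz = (\<lambda>p. - dz e p *s x p)" and L_xw: "L xw = (\<lambda>p. - dzbar e p *s x p)"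
  by (simp_all add: fun_eq_iff L_dz L_dzbar L_x vec_eq_iff)

end

section \<open>Doubly periodic holomorphic functions\<close>

lemma dzbar_zero_holomorphic:
  assumes "smooth F" "\<And>p. dzbar F p = 0"
  shows "F holomorphic_on UNIV"
proof -
  have "(F has_field_derivative dir_deriv 1 F p) (at p)" for p
  proof -
    have lin: "linear (\<lambda>v. dir_deriv v F p)"
      using smooth_on_differentiable[OF assms(1) UNIV_I] by (rule linear_frechet_derivative)
    have "dir_deriv 1 F p + \<i> * dir_deriv \<i> F p = 0" using assms(2)[of p] by (simp add: dzbar_def)
    then have "\<i> * (dir_deriv 1 F p + \<i> * dir_deriv \<i> F p) = 0" by simp
    then have i: "dir_deriv \<i> F p = \<i> * dir_deriv 1 F p" by (simp add: ring_distribs)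
    have "dir_deriv v F p = dir_deriv 1 F p * v" for v
    proof -
      have "v = Re v *\<^sub>R 1 + Im v *\<^sub>R \<i>" by (simp add: complex_eq_iff)
      then have "dir_deriv v F p = dir_deriv (Re v *\<^sub>R 1 + Im v *\<^sub>R \<i>) F p" by (rule arg_cong)
      also have "\<dots> = Re v *\<^sub>R dir_deriv 1 F p + Im v *\<^sub>R dir_deriv \<i> F p"
        by (simp only: linear_add[OF lin] linear_scale[OF lin])
      also have "\<dots> = dir_deriv 1 F p * (complex_of_real (Re v) + \<i> * complex_of_real (Im v))"
        by (simp add: i scaleR_conv_of_real algebra_simps)
      finally show ?thesis by (simp only: complex_eq[symmetric])
    qed
    then have "(\<lambda>v. dir_deriv v F p) = (*) (dir_deriv 1 F p)" by (rule ext)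
    from has_derivative_eq_rhs[OF smooth_has_derivative[OF assms(1)] this] show ?thesis
      unfolding has_field_derivative_def .
  qed
  then show ?thesis by (meson holomorphic_on_open open_UNIV)
qed

lemma periodic_int:
  fixes F :: "complex \<Rightarrow> 'a"
  assumes "\<And>p. F (p + w) = F p"
  shows "F (p + of_int k * w) = F p"
proof -
  have nat: "F (q + of_nat n * w) = F q" for q n
  proof (induction n)
    case (Suc n)
    then show ?case using assms[of "q + of_nat n * w"] by (simp add: algebra_simps)
  qed simp
  show ?thesis
  proof (cases "k \<ge> 0")
    case True
    then show ?thesis using nat[of p "nat k"] by simp
  next
    case False
    then show ?thesis using nat[of "p + of_int k * w" "nat (- k)"] by simp
  qed
qed

text \<open>Cramer's rule for the real basis \<open>\<omega>1, \<omega>2\<close> of the plane.\<close>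

lemma lattice_coordinates:
  assumes "lattice_basis \<omega>1 \<omega>2"
  obtains r s where "p = complex_of_real r * \<omega>1 + complex_of_real s * \<omega>2"
proof -
  define d where "d = Im (cnj \<omega>1 * \<omega>2)"
  have d: "d \<noteq> 0" using assms by (simp add: lattice_basis_def d_def)
  define A B where "A = Im (cnj p * \<omega>2)" and "B = Im (cnj \<omega>1 * p)"
  have "complex_of_real d * p = complex_of_real A * \<omega>1 + complex_of_real B * \<omega>2"
    by (simp add: complex_eq_iff d_def A_def B_def algebra_simps)
  then have "p = complex_of_real (A / d) * \<omega>1 + complex_of_real (B / d) * \<omega>2"
    using d by (simp add: field_simps)
  then show ?thesis by (rule that)
qed

lemma periodic_bounded:
  fixes F :: "complex \<Rightarrow> complex"
  assumes "lattice_basis \<omega>1 \<omega>2" "doubly_periodic \<omega>1 \<omega>2 F" "continuous_on UNIV F"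
  shows "bounded (range F)"
proof -
  define P where "P = (\<lambda>(r, s). complex_of_real r * \<omega>1 + complex_of_real s * \<omega>2)"
  have "compact (P ` ({0..1} \<times> {0..1}))"
    unfolding P_def case_prod_unfold
    by (intro compact_continuous_image compact_Times compact_Icc continuous_intros)
  then have "compact (F ` P ` ({0..1} \<times> {0..1}))"
    using compact_continuous_image[OF continuous_on_subset[OF assms(3)]] by blast
  moreover have "range F \<subseteq> F ` P ` ({0..1} \<times> {0..1})"
  proof
    fix y assume "y \<in> range F"
    then obtain p where y: "y = F p" by blast
    obtain r s where p: "p = complex_of_real r * \<omega>1 + complex_of_real s * \<omega>2"
      using lattice_coordinates[OF assms(1)] by blast
    have per: "F (q + of_int k * \<omega>1) = F q" "F (q + of_int k * \<omega>2) = F q" for q k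
      using assms(2) by (auto simp: doubly_periodic_def intro: periodic_int)
    have split: "complex_of_real u = complex_of_real (frac u) + of_int \<lfloor>u\<rfloor>" for u
      by (metis frac_def of_real_add of_real_of_int_eq diff_add_cancel)
    have "p = P (frac r, frac s) + of_int \<lfloor>r\<rfloor> * \<omega>1 + of_int \<lfloor>s\<rfloor> * \<omega>2"
      unfolding p P_def by (subst split[of r], subst split[of s]) (simp add: algebra_simps)
    then have "F p = F (P (frac r, frac s))" by (simp add: per)
    moreover have "(frac r, frac s) \<in> {0..1} \<times> {0..1}"
      using frac_lt_1[of r] frac_lt_1[of s] by simp
    ultimately show "y \<in> F ` P ` ({0..1} \<times> {0..1})" using y by blast
  qed
  ultimately show ?thesis using compact_imp_bounded bounded_subset by blast
qed

lemma periodic_dzbar_constant: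
  assumes "lattice_basis \<omega>1 \<omega>2" "doubly_periodic \<omega>1 \<omega>2 F" "smooth F" "\<And>p. dzbar F p = 0"
  obtains C where "F = (\<lambda>p. C)"
  using Liouville_theorem[OF dzbar_zero_holomorphic[OF assms(3,4)]
      periodic_bounded[OF assms(1,2) smooth_on_continuous[OF assms(3)]]]
  by (auto simp: constant_on_def)

lemma periodic_dz:
  assumes "smooth f" "\<And>p. f (p + w) = f p"
  shows "dz f (p + w) = dz f p" "dzbar f (p + w) = dzbar f p"
proof -
  have shift: "(\<lambda>y. f (w + y)) = f"
  proof
    fix y
    show "f (w + y) = f y" using assms(2)[of y] by (simp only: add.commute[of w y])
  qed
  have "dir_deriv v (\<lambda>y. f (w + y)) p = dir_deriv v f (w + p)" for v
    by (rule dir_deriv_affine[OF bounded_linear_ident smooth_on_differentiable[OF assms(1) UNIV_I]])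
  then have "dir_deriv v f p = dir_deriv v f (p + w)" for v
    unfolding shift add.commute[of w p] .
  then show "dz f (p + w) = dz f p" "dzbar f (p + w) = dzbar f p"
    by (simp_all add: dz_def dzbar_def)
qed

lemma periodic_dz_vec:
  assumes "vsmooth g" "\<And>p. g (p + w) = g p"
  shows "dz_vec g (p + w) = dz_vec g p" "dzbar_vec g (p + w) = dzbar_vec g p"
  using periodic_dz[of "\<lambda>p. g p $ i" w p for i] assms by (simp_all add: vec_eq_iff)

section \<open>Conformal variations of isothermic surfaces\<close>

context isothermic_lift begin

lemma \<sigma>_orth [simp]:
  "lorentz (\<sigma> p) (x p) = 0" "lorentz (\<sigma> p) (xz p) = 0" "lorentz (\<sigma> p) (xw p) = 0"
  "lorentz (\<sigma> p) (xzw p) = 0"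
  using \<kappa>z_orth[of p] \<kappa>w_orth[of p] by (simp_all add: \<sigma>_eq)

definition L_\<kappa>_coeff where "L_\<kappa>_coeff = (\<lambda>p. (dz (dz c) p - dzbar (dzbar c) p) / 2 - dz (dz e) p)"

lemma smooth_L_\<kappa>_coeff [simp]: "smooth L_\<kappa>_coeff" by (simp add: L_\<kappa>_coeff_def)

text \<open>Codazzi equation: the normal part of \<open>L \<kappa>\<close> vanishes. It follows from \<open>L x = 0\<close> by applying
  the commutator rules to \<open>\<kappa> = x\<^sub>z\<^sub>z + c x / 2\<close>; the Gauss equation then simplifies the
  coefficients.\<close>

lemma L_\<kappa>: "L \<kappa> = (\<lambda>p. (4 * dzbar h p) *s xz p - (4 * dz h p) *s xw p
    + L_\<kappa>_coeff p *s x p)"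
proof
  fix p
  have e: "2 * dz e p = dz c p - 4 * dzbar h p"
    by (simp add: e_def dz_cnj_c[unfolded dz_cnj[OF smooth_c]])
  have "L \<kappa> p = L (dz_vec xz) p + L (\<lambda>p. (c p / 2) *s x p) p"
    by (subst \<kappa>_eq) (simp add: L_add)
  also have "L (dz_vec xz) p = - dz (dz e) p *s x p - (2 * dz e p) *s xz p"
    by (simp add: L_dz L_xz vec_eq_iff algebra_simps)
  also have "L (\<lambda>p. (c p / 2) *s x p) p
      = dz c p *s xz p - dzbar c p *s xw p + ((dz (dz c) p - dzbar (dzbar c) p) / 2) *s x p"
    by (subst L_scale) (simp_all add: L_x vec_eq_iff algebra_simps diff_divide_distrib)
  finally show "L \<kappa> p = (4 * dzbar h p) *s xz p - (4 * dz h p) *s xw p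
    + L_\<kappa>_coeff p *s x p"
    unfolding e by (simp add: L_\<kappa>_coeff_def dzbar_c vec_eq_iff algebra_simps)
qed

text \<open>In this and the following lemmas the multiple of \<open>\<kappa>\<close> that is taken off is the normal part
  of \<open>L\<close> applied to one summand of the variation.\<close>

lemma L_dz_\<kappa>: "L (dz_vec \<kappa>) p - (4 * dzbar h p - dz e p) *s \<kappa> p \<in> V_fibre \<psi> p"
proof -
  have "L (dz_vec \<kappa>) p - (4 * dzbar h p - dz e p) *s \<kappa> p
    = (4 * dz (dzbar h) p) *s xz p - (2 * dzbar h p * c p) *s x p - (4 * dz (dz h) p) *s xw p
      - (4 * dz h p) *s xzw p + dz L_\<kappa>_coeff p *s x p + L_\<kappa>_coeff p *s xz p"
    by (simp add: L_dz L_\<kappa> xzz vec_eq_iff algebra_simps)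
  also have "\<dots> \<in> V_fibre \<psi> p" by (intro V_intros)
  finally show ?thesis .
qed

lemma L_dzbar_\<kappa>: "L (dzbar_vec \<kappa>) p - (- 4 * dz h p - dzbar e p) *s \<kappa> p \<in> V_fibre \<psi> p"
proof -
  have "L (dzbar_vec \<kappa>) p - (- 4 * dz h p - dzbar e p) *s \<kappa> p
    = (4 * dzbar (dzbar h) p) *s xz p + (4 * dzbar h p) *s xzw p - (4 * dz (dzbar h) p) *s xw p
      + (2 * dz h p * cnj (c p)) *s x p + dzbar L_\<kappa>_coeff p *s x p + L_\<kappa>_coeff p *s xw p"
    by (simp add: L_dzbar L_\<kappa> xww vec_eq_iff algebra_simps)
  also have "\<dots> \<in> V_fibre \<psi> p" by (intro V_intros)
  finally show ?thesis .
qed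

lemma L_scale_x: "smooth f \<Longrightarrow> L (\<lambda>p. f p *s x p) p \<in> V_fibre \<psi> p"
  by (subst L_scale) (auto simp: L_x intro!: V_intros)

lemma L_scale_xz:
  assumes [simp]: "smooth f"
  shows "L (\<lambda>p. f p *s xz p) p - (2 * dz f p) *s \<kappa> p \<in> V_fibre \<psi> p"
proof -
  have "L (\<lambda>p. f p *s xz p) p - (2 * dz f p) *s \<kappa> p =
    - (f p * dz e p) *s x p - (dz f p * c p) *s x p - (2 * dzbar f p) *s xzw p
    + (dz (dz f) p - dzbar (dzbar f) p) *s xz p"
    by (subst L_scale) (simp_all add: L_xz xzz vec_eq_iff algebra_simps)
  also have "\<dots> \<in> V_fibre \<psi> p" by (intro V_intros)
  finally show ?thesis .
qed

lemma L_scale_xw: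
  assumes [simp]: "smooth f"
  shows "L (\<lambda>p. f p *s xw p) p + (2 * dzbar f p) *s \<kappa> p \<in> V_fibre \<psi> p"
proof -
  have "L (\<lambda>p. f p *s xw p) p + (2 * dzbar f p) *s \<kappa> p =
    - (f p * dzbar e p) *s x p + (dzbar f p * cnj (c p)) *s x p + (2 * dz f p) *s xzw p
    + (dz (dz f) p - dzbar (dzbar f) p) *s xw p"
    by (subst L_scale) (simp_all add: L_xw xww vec_eq_iff algebra_simps)
  also have "\<dots> \<in> V_fibre \<psi> p" by (intro V_intros)
  finally show ?thesis .
qed

text \<open>The normal parts of the summands add up to \<open>\<kappa>\<close> times \<open>4 (h\<^sub>w - h\<^sub>z) - e\<^sub>z - e\<^sub>w + 2 g\<^sub>z -
  2 (cnj g)\<^sub>w\<close> with \<open>g = 2 h + b\<close>, and this factor is zero for the given \<open>b\<close>.\<close>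

lemma L_variation:
  assumes a: "smooth a" and b: "b = (\<lambda>p. h p + c p / 4 + C)"
    and T: "T = (\<lambda>p. a p *s x p + b p *s xz p + cnj (b p) *s xw p + \<sigma> p)"
  shows "L T p \<in> V_fibre \<psi> p"
proof -
  have [simp]: "smooth b" by (simp add: b)
  note a [simp]
  define u where "u = (\<lambda>p. a p - (dz h p + dzbar h p))"
  define g where "g = (\<lambda>p. 2 * h p + b p)"
  have [simp]: "smooth u" "smooth g" by (simp_all add: u_def g_def)
  have T': "T
      = (\<lambda>p. dz_vec \<kappa> p + (dzbar_vec \<kappa> p + (g p *s xz p + (cnj (g p) *s xw p + u p *s x p))))"
    by (simp add: T \<sigma>_eq g_def u_def fun_eq_iff vec_eq_iff algebra_simps)
  have LT: "L T p = L (dz_vec \<kappa>) p + (L (dzbar_vec \<kappa>) p + (L (\<lambda>p. g p *s xz p) p +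
      (L (\<lambda>p. cnj (g p) *s xw p) p + L (\<lambda>p. u p *s x p) p)))"
    unfolding T' by (simp add: L_add)
  have zero: "(4 * dzbar h p - dz e p) + (- 4 * dz h p - dzbar e p) + 2 * dz g p
      - 2 * dzbar (\<lambda>p. cnj (g p)) p = 0"
    by (simp add: g_def b e_def dzbar_c field_simps)
  have "L T p = (L (dz_vec \<kappa>) p - (4 * dzbar h p - dz e p) *s \<kappa> p)
    + (L (dzbar_vec \<kappa>) p - (- 4 * dz h p - dzbar e p) *s \<kappa> p)
    + (L (\<lambda>p. g p *s xz p) p - (2 * dz g p) *s \<kappa> p)
    + (L (\<lambda>p. cnj (g p) *s xw p) p + (2 * dzbar (\<lambda>p. cnj (g p)) p) *s \<kappa> p)
    + L (\<lambda>p. u p *s x p) p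
    + ((4 * dzbar h p - dz e p) + (- 4 * dz h p - dzbar e p) + 2 * dz g p
      - 2 * dzbar (\<lambda>p. cnj (g p)) p) *s \<kappa> p"
    unfolding LT by (simp add: vec_eq_iff algebra_simps)
  also have "\<dots> \<in> V_fibre \<psi> p"
    unfolding zero
    by (intro V_fibre_add L_dz_\<kappa> L_dzbar_\<kappa> L_scale_xz L_scale_xw L_scale_x)
      (simp_all add: V_fibre_def vec.span_zero)
  finally show ?thesis .
qed

text \<open>Conformality of the variation determines \<open>b\<close> up to a holomorphic function, and periodicity
  makes that function constant. The coefficients \<open>a\<close> and \<open>b\<close> are smooth since they are inner
  products of \<open>T\<close> with the frame.\<close>

lemma L_conformal_variation:
  assumes lattice: "lattice_basis \<omega>1 \<omega>2"
    and periodic: "doubly_periodic \<omega>1 \<omega>2 \<psi>" "doubly_periodic \<omega>1 \<omega>2 T"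
    and [simp]: "vsmooth T"
    and conformal: "\<And>p. lorentz (dz_vec T p) (xz p) = 0"
    and T: "\<And>p. T p = a p *s x p + b p *s xz p + cnj (b p) *s xw p + \<sigma> p"
  shows "L T p \<in> V_fibre \<psi> p"
proof -
  have b: "b = (\<lambda>p. 2 * lorentz (T p) (xw p))"
    and b': "(\<lambda>p. cnj (b p)) = (\<lambda>p. 2 * lorentz (T p) (xz p))"
    and a: "a = (\<lambda>p. - 2 * lorentz (T p) (xzw p))"
    by (simp_all add: T)
  have [simp]: "smooth b" by (simp add: b)
  have smooth_a: "smooth a" by (simp add: a)
  define G where "G = (\<lambda>p. b p - (h p + c p / 4))"
  have "dzbar G p = 0" for p
  proof -
    have "cnj (dzbar b p) = dz (\<lambda>p. cnj (b p)) p" by simp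
    also have "\<dots> = 2 * lorentz (T p) (dz_vec xz p)" unfolding b' by (simp add: conformal)
    also have "\<dots> = 2 * lorentz (\<sigma> p) (\<kappa> p)" by (simp add: xzz T)
    also have "\<dots> = cnj (dzbar (\<lambda>q. h q + c q / 4) p)" by (simp flip: explicit_b)
    finally have "dzbar b p = dzbar (\<lambda>q. h q + c q / 4) p" by (simp only: complex_cnj_cancel_iff)
    then show ?thesis by (simp add: G_def)
  qed
  moreover have [simp]: "smooth G" by (simp add: G_def)
  moreover have "doubly_periodic \<omega>1 \<omega>2 G"
  proof -
    have "G (p + w) = G p" if "\<And>p. \<psi> (p + w) = \<psi> p" "\<And>p. T (p + w) = T p" for p w
    proof -
      have x: "x (p + w) = x p" for p by (simp add: that)
      have xz: "xz (p + w) = xz p"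
        and xw: "xw (p + w) = xw p" for p using periodic_dz_vec[of x w] x by simp_all
      have xzz: "dz_vec xz (p + w) = dz_vec xz p" and xzw: "xzw (p + w) = xzw p" for p
        using periodic_dz_vec[of xz w] periodic_dz_vec[of xw w] xz xw by simp_all
      show ?thesis unfolding G_def b h_def \<kappa>_eq c_eq by (simp add: that xz xw xzz xzw)
    qed
    then show ?thesis using periodic by (simp add: doubly_periodic_def)
  qed
  ultimately obtain C where "G = (\<lambda>p. C)"
    using periodic_dzbar_constant[OF lattice] by metis
  then have "b = (\<lambda>p. h p + c p / 4 + C)" by (auto simp: G_def fun_eq_iff algebra_simps)
  moreover have "T = (\<lambda>p. a p *s x p + b p *s xz p + cnj (b p) *s xw p + \<sigma> p)"
    using T by (rule ext)
  ultimately show ?thesis by (rule L_variation[OF smooth_a])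
qed

end

section \<open>Families depending smoothly on time\<close>

definition smooth_family :: "real set \<Rightarrow> (real \<Rightarrow> complex \<Rightarrow> complex) \<Rightarrow> bool" where
  "smooth_family I g \<longleftrightarrow> smooth_on (I \<times> UNIV) (\<lambda>(t, p). g t p)"

definition dt :: "(real \<Rightarrow> complex \<Rightarrow> complex) \<Rightarrow> real \<Rightarrow> complex \<Rightarrow> complex" where
  "dt g t p = vector_derivative (\<lambda>s. g s p) (at t)"

abbreviation joint :: "(real \<Rightarrow> complex \<Rightarrow> complex) \<Rightarrow> real \<times> complex \<Rightarrow> complex" where
  "joint g \<equiv> \<lambda>(t, p). g t p"

context
  fixes I :: "real set" and g :: "real \<Rightarrow> complex \<Rightarrow> complex"
  assumes I: "open I" and g: "smooth_family I g"
begin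

lemma open_cylinder: "open (I \<times> (UNIV :: complex set))"
  using I by (simp add: open_Times)

lemma smooth_joint: "smooth_on (I \<times> UNIV) (joint g)"
  using g by (simp add: smooth_family_def)

lemma joint_differentiable: "t \<in> I \<Longrightarrow> joint g differentiable (at (t, p))"
  using smooth_on_differentiable[OF smooth_joint] by simp

lemma slice_linear: "bounded_linear (\<lambda>p::complex. (0::real, p))"
  by (intro bounded_linear_Pair bounded_linear_zero bounded_linear_ident)

lemma smooth_slice: "t \<in> I \<Longrightarrow> smooth (g t)"
  using smooth_on_affine[OF slice_linear open_UNIV _ smooth_joint, of "(t, 0)"] by simp

lemma slice_deriv: "t \<in> I \<Longrightarrow> dir_deriv v (g t) p = dir_deriv (0, v) (joint g) (t, p)"
  using dir_deriv_affine(1)[OF slice_linear, where f = "joint g" and a = "(t, 0)" and v = v and x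
      = p]
    joint_differentiable[of t p] by simp

lemma has_dt: "t \<in> I \<Longrightarrow> ((\<lambda>s. g s p) has_vector_derivative dir_deriv (1, 0) (joint g) (t, p)) (at t)"
proof -
  assume t: "t \<in> I"
  have 1: "((\<lambda>s. (s, p)) has_derivative (\<lambda>h. (h, 0))) (at t)"
    by (auto intro!: derivative_eq_intros)
  have "((\<lambda>s. joint g (s, p)) has_derivative (\<lambda>h. dir_deriv (h, 0) (joint g) (t, p))) (at t)"
    using has_derivative_compose[where g
        = "joint g", OF 1 has_dir_deriv[OF joint_differentiable[OF t]]] .
  moreover have "(\<lambda>h. dir_deriv (h, 0) (joint g) (t, p))
      = (\<lambda>h. h *\<^sub>R dir_deriv (1, 0) (joint g) (t, p))"
  proof
    fix h
    have "dir_deriv (h *\<^sub>R (1, 0)) (joint g) (t, p) = h *\<^sub>R dir_deriv (1, 0) (joint g) (t, p)"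
      by (rule linear_scale[OF linear_frechet_derivative[OF joint_differentiable[OF t]]])
    then show "dir_deriv (h, 0) (joint g) (t, p) = h *\<^sub>R dir_deriv (1, 0) (joint g) (t, p)"
      by (simp only: scaleR_Pair scaleR_zero_right real_scaleR_def mult_1_right)
  qed
  ultimately have "((\<lambda>s. joint g (s, p)) has_derivative (\<lambda>h. h *\<^sub>R dir_deriv (1, 0) (joint g) (t,
      p))) (at t)"
    by (rule has_derivative_eq_rhs)
  then show ?thesis unfolding has_vector_derivative_def prod.case .
qed

lemma dt_eq: "t \<in> I \<Longrightarrow> dt g t p = dir_deriv (1, 0) (joint g) (t, p)"
  unfolding dt_def using has_dt by (rule vector_derivative_at)

lemma has_vector_derivative_dt: "t \<in> I \<Longrightarrow> ((\<lambda>s. g s p) has_vector_derivative dt g t p) (at t)"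
  using has_dt dt_eq by simp

lemma smooth_family_dt: "smooth_family I (dt g)"
proof -
  have "smooth_on (I \<times> UNIV) (dir_deriv (1, 0) (joint g))"
    by (rule smooth_on_dir_deriv[OF smooth_joint])
  then show ?thesis unfolding smooth_family_def
    by (subst smooth_on_cong_open[OF open_cylinder, where g
        = "dir_deriv (1, 0) (joint g)"]) (auto simp: dt_eq)
qed

lemma smooth_combination:
  "smooth_on (I \<times> UNIV) (\<lambda>x. (dir_deriv (0, 1) (joint g) x + a * dir_deriv (0, \<i>) (joint g) x) / 2)"
  using smooth_on_linear[OF bounded_linear_divide open_cylinder
      smooth_on_add[OF open_cylinder smooth_on_dir_deriv[OF smooth_joint]
        smooth_on_linear[OF bounded_linear_mult_right open_cylinder smooth_on_dir_deriv[OF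
            smooth_joint]]]] .

lemma smooth_family_dz: "smooth_family I (\<lambda>t. dz (g t))"
  and smooth_family_dzbar: "smooth_family I (\<lambda>t. dzbar (g t))"
proof -
  show "smooth_family I (\<lambda>t. dz (g t))" unfolding smooth_family_def
    by (subst smooth_on_cong_open[OF open_cylinder,
          where g = "\<lambda>x. (dir_deriv (0, 1) (joint g) x
              + (- \<i>) * dir_deriv (0, \<i>) (joint g) x) / 2"])
      (auto simp: dz_def slice_deriv intro: smooth_combination[of "- \<i>", simplified])
  show "smooth_family I (\<lambda>t. dzbar (g t))" unfolding smooth_family_def
    by (subst smooth_on_cong_open[OF open_cylinder,
          where g = "\<lambda>x. (dir_deriv (0, 1) (joint g) x + \<i> * dir_deriv (0, \<i>) (joint g) x) / 2"])
      (auto simp: dzbar_def slice_deriv intro: smooth_combination)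
qed

lemma smooth_family_slice_deriv: "smooth_family I (\<lambda>t. dir_deriv v (g t))"
  unfolding smooth_family_def
  by (subst smooth_on_cong_open[OF open_cylinder, where g = "dir_deriv (0, v) (joint g)"])
    (auto simp: slice_deriv smooth_on_dir_deriv[OF smooth_joint])

end

text \<open>Equality of mixed partial derivatives, for the time direction and a space direction.\<close>

lemma dt_slice_deriv:
  assumes I: "open I" and g: "smooth_family I g" and t: "t \<in> I"
  shows "((\<lambda>s. dir_deriv v (g s) p) has_vector_derivative dir_deriv v (dt g t) p) (at t)"
proof -
  note cyl = open_cylinder[OF I g]
  have tp: "(t, p) \<in> I \<times> UNIV" using t by simp
  have eq: "dt (\<lambda>t. dir_deriv v (g t)) t p = dir_deriv v (dt g t) p"
  proof -
    have "dt (\<lambda>t. dir_deriv v (g t)) t p = dir_deriv (1, 0) (\<lambda>(t, p). dir_deriv v (g t) p) (t, p)"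
      by (rule dt_eq[OF I smooth_family_slice_deriv[OF I g] t])
    also have "\<dots> = dir_deriv (1, 0) (dir_deriv (0, v) (joint g)) (t, p)"
      by (rule dir_deriv_cong_open[OF cyl tp]) (auto simp: slice_deriv[OF I g])
    also have "\<dots> = dir_deriv (0, v) (dir_deriv (1, 0) (joint g)) (t, p)"
      by (rule dir_deriv_commute[OF cyl smooth_joint[OF I g] tp])
    also have "\<dots> = dir_deriv (0, v) (\<lambda>(t, p). dt g t p) (t, p)"
      by (rule dir_deriv_cong_open[OF cyl tp]) (auto simp: dt_eq[OF I g])
    also have "\<dots> = dir_deriv v (dt g t) p"
      by (rule slice_deriv[OF I smooth_family_dt[OF I g] t, symmetric])
    finally show ?thesis .
  qed
  show ?thesis
    using has_vector_derivative_dt[OF I smooth_family_slice_deriv[OF I g, where v = v] t, where p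
        = p]
    unfolding eq .
qed

lemma
  assumes I: "open I" and g: "smooth_family I g" and t: "t \<in> I"
  shows dt_dz: "((\<lambda>s. dz (g s) p) has_vector_derivative dz (dt g t) p) (at t)"
    and dt_dzbar: "((\<lambda>s. dzbar (g s) p) has_vector_derivative dzbar (dt g t) p) (at t)"
  unfolding dz_def dzbar_def
  by (intro has_vector_derivative_divide has_vector_derivative_diff has_vector_derivative_add
      has_vector_derivative_mult_right dt_slice_deriv[OF I g t])+

lemma has_vector_derivative_vec:
  fixes f :: "real \<Rightarrow> 'b::euclidean_space ^ 'k::finite"
  assumes "\<And>i. ((\<lambda>s. f s $ i) has_vector_derivative d $ i) (at t)"
  shows "(f has_vector_derivative d) (at t)"
  unfolding has_vector_derivative_def
proof (subst has_derivative_componentwise_within, intro ballI)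
  fix b :: "'b ^ 'k" assume "b \<in> Basis"
  then obtain i u where b: "b = axis i u" by (auto simp: Basis_vec_def)
  show "((\<lambda>s. f s \<bullet> b) has_derivative (\<lambda>h. h *\<^sub>R d \<bullet> b)) (at t)"
    unfolding b inner_axis using has_derivative_inner_left[OF assms[of i, unfolded
        has_vector_derivative_def]]
    by simp
qed

lemma dt_vec:
  fixes y :: "real \<Rightarrow> complex \<Rightarrow> complex ^ 'k::finite"
  assumes I: "open I" and y: "\<And>i. smooth_family I (\<lambda>s p. y s p $ i)" and t: "t \<in> I"
  defines "T \<equiv> (\<lambda>p. \<chi> i. dt (\<lambda>s p. y s p $ i) t p)"
  shows has_vector_derivative_dt_vec: "((\<lambda>s. y s p) has_vector_derivative T p) (at t)"
    and vsmooth_dt_vec: "vsmooth T"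
    and dt_dz_vec: "((\<lambda>s. dz_vec (y s) p) has_vector_derivative dz_vec T p) (at t)"
    and dt_dzbar_vec: "((\<lambda>s. dzbar_vec (y s) p) has_vector_derivative dzbar_vec T p) (at t)"
  using smooth_slice[OF I smooth_family_dt[OF I y] t]
  by (auto intro!: has_vector_derivative_vec
      simp: T_def vsmooth_def has_vector_derivative_dt[OF I y t] dt_dz[OF I y t] dt_dzbar[OF I y t])

lemma has_vector_derivative_lorentz:
  fixes f g :: "real \<Rightarrow> complex ^ 'm::finite option"
  assumes "(f has_vector_derivative f') (at t)" "(g has_vector_derivative g') (at t)"
  shows "((\<lambda>s. lorentz (f s) (g s)) has_vector_derivative lorentz f' (g t)
      + lorentz (f t) g') (at t)"
proof -
  have c: "((\<lambda>s. f s $ i) has_vector_derivative f' $ i) (at t)"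
    "((\<lambda>s. g s $ i) has_vector_derivative g' $ i) (at t)" for i
    by (rule bounded_linear.has_vector_derivative[OF bounded_linear_vec_nth] assms)+
  have "lorentz f' (g t) + lorentz (f t) g'
      = (\<Sum>i\<in>UNIV. metric_sign i * (f t $ i * g' $ i + f' $ i * g t $ i))"
    by (simp add: lorentz_sum sum.distrib[symmetric] algebra_simps)
  then show ?thesis
    unfolding lorentz_sum[of "f _" "g _"]
    by (auto intro!: has_vector_derivative_sum has_vector_derivative_mult_right
        has_vector_derivative_mult c)
qed

lemma has_vector_derivative_scale:
  fixes f :: "real \<Rightarrow> complex" and g :: "real \<Rightarrow> complex ^ 'k::finite"
  assumes "(f has_vector_derivative f') (at t)" "(g has_vector_derivative g') (at t)"
  shows "((\<lambda>s. f s *s g s) has_vector_derivative f t *s g' + f' *s g t) (at t)"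
proof (rule has_vector_derivative_vec)
  fix i
  have "((\<lambda>s. g s $ i) has_vector_derivative g' $ i) (at t)"
    by (rule bounded_linear.has_vector_derivative[OF bounded_linear_vec_nth assms(2)])
  from has_vector_derivative_mult[OF assms(1) this]
  show "((\<lambda>s. (f s *s g s) $ i) has_vector_derivative (f t *s g' + f' *s g t) $ i) (at t)" by simp
qed

section \<open>Smoothness of normalized lifts in time\<close>

lemma lorentz_real:
  fixes v :: "real ^ 'm::finite option"
  assumes "\<And>k. v $ Some k = u $ k"
  shows "lorentz v v = u \<bullet> u - (v $ None)\<^sup>2"
  by (simp add: lorentz_def assms inner_vec_def power2_eq_square)

text \<open>The lift is \<open>\<nu> (1, f)\<close> with \<open>\<nu> > 0\<close>. As \<open>(1, f)\<close> is null and orthogonal to its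
  derivatives, the induced metric of the lift is \<open>\<nu>\<^sup>2\<close> times that of \<open>f\<close>, so the normalization
  forces \<open>\<nu>\<close>.\<close>

lemma normalized_lift_factor:
  fixes f :: "complex \<Rightarrow> real ^ 'm::finite"
  assumes "normalized_lift \<omega>1 \<omega>2 f \<psi>" and diff: "f differentiable (at p)"
    and sphere: "\<And>p. f p \<in> sphere 0 1"
  defines "\<rho> \<equiv> dir_deriv 1 f p \<bullet> dir_deriv 1 f p"
  shows "\<rho> > 0" "\<psi> p $ None = \<rho> powr (- (1 / 2))" "\<psi> p $ Some k = \<rho> powr (- (1 / 2)) * f p $ k"
proof -
  have smooth: "smooth_on UNIV \<psi>" and pos: "\<psi> q $ None > 0"
    and sp: "span {\<psi> q} = span {light_vector (f q)}"
    and iso: "lorentz (dir_deriv v \<psi> q) (dir_deriv v \<psi> q) = (norm v)\<^sup>2" for q v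
    using assms(1) by (auto simp: normalized_lift_def forward_light_cone_def)
  have comp: "\<psi> q $ Some k = \<psi> q $ None * f q $ k" for q k
  proof -
    have "\<psi> q \<in> span {light_vector (f q)}" using sp[of q] span_base by blast
    then obtain r where r: "\<psi> q = r *\<^sub>R light_vector (f q)" by (auto simp: span_singleton)
    then show ?thesis by (simp add: light_vector_def)
  qed
  define D where "D = dir_deriv 1 f p"
  define d where "d = dir_deriv 1 \<psi> p $ None"
  have psi': "(\<psi> has_derivative (\<lambda>v. dir_deriv v \<psi> p)) (at p)"
    by (rule has_dir_deriv[OF smooth_on_differentiable[OF smooth UNIV_I]])
  have f': "(f has_derivative (\<lambda>v. dir_deriv v f p)) (at p)"
    by (rule has_dir_deriv[OF diff])
  have nu': "((\<lambda>q. \<psi> q $ None) has_derivative (\<lambda>v. dir_deriv v \<psi> p $ None)) (at p)"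
    by (rule bounded_linear.has_derivative[OF bounded_linear_vec_nth psi'])
  have comp': "dir_deriv 1 \<psi> p $ Some k = (d *\<^sub>R f p + \<psi> p $ None *\<^sub>R D) $ k" for k
  proof -
    have "((\<lambda>q. \<psi> q $ Some k) has_derivative (\<lambda>v. dir_deriv v \<psi> p $ Some k)) (at p)"
      by (rule bounded_linear.has_derivative[OF bounded_linear_vec_nth psi'])
    moreover have "((\<lambda>q. \<psi> q $ Some k) has_derivative
        (\<lambda>v. \<psi> p $ None * dir_deriv v f p $ k + dir_deriv v \<psi> p $ None * f p $ k)) (at p)"
      unfolding comp
      by (rule has_derivative_mult[OF nu' bounded_linear.has_derivative[OF bounded_linear_vec_nth
          f']])
    ultimately have "(\<lambda>v. dir_deriv v \<psi> p $ Some k) =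
        (\<lambda>v. \<psi> p $ None * dir_deriv v f p $ k + dir_deriv v \<psi> p $ None * f p $ k)"
      by (rule has_derivative_unique)
    from fun_cong[OF this, of 1] show ?thesis by (simp add: d_def D_def)
  qed
  have ff: "f q \<bullet> f q = 1" for q using sphere[of q] by (simp add: dot_square_norm)
  have fD: "f p \<bullet> D = 0"
  proof -
    have "((\<lambda>q. f q \<bullet> f q) has_derivative (\<lambda>v. f p \<bullet> dir_deriv v f p
        + dir_deriv v f p \<bullet> f p)) (at p)"
      by (rule has_derivative_inner[OF f' f'])
    moreover have "((\<lambda>q. f q \<bullet> f q) has_derivative (\<lambda>v. 0)) (at p)" unfolding ff by simp
    ultimately have "(\<lambda>v. f p \<bullet> dir_deriv v f p + dir_deriv v f p \<bullet> f p) = (\<lambda>v. 0)"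
      by (rule has_derivative_unique)
    from fun_cong[OF this, of 1] show ?thesis by (simp add: D_def inner_commute)
  qed
  have "1 = lorentz (dir_deriv 1 \<psi> p) (dir_deriv 1 \<psi> p)" using iso[where v = 1 and q = p] by simp
  also have "\<dots> = (\<psi> p $ None)\<^sup>2 * \<rho>"
    using lorentz_real[OF comp'] ff[of p] fD
    by (simp add: d_def[symmetric] \<rho>_def D_def[symmetric] inner_add inner_commute[of D "f p"]
        power2_eq_square)
  finally have 1: "(\<psi> p $ None)\<^sup>2 * \<rho> = 1" by simp
  then show "\<rho> > 0" using pos[of p] by (metis zero_less_mult_pos zero_less_one zero_less_power)
  then have "sqrt \<rho> * \<psi> p $ None = 1"
    using 1 pos[of p] by (metis abs_of_pos real_sqrt_abs real_sqrt_mult real_sqrt_one mult.commute)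
  then have "\<psi> p $ None = 1 / sqrt \<rho>" using \<open>\<rho> > 0\<close> by (simp add: eq_divide_eq mult.commute)
  also have "\<dots> = \<rho> powr (- (1 / 2))"
    using \<open>\<rho> > 0\<close> by (simp add: powr_minus_divide powr_half_sqrt)
  finally show None: "\<psi> p $ None = \<rho> powr (- (1 / 2))" .
  show "\<psi> p $ Some k = \<rho> powr (- (1 / 2)) * f p $ k" unfolding comp None ..
qed

text \<open>Each lift is smooth in space by definition; the explicit scaling factor shows that it is
  also smooth in time.\<close>

lemma smooth_family_lift:
  fixes f :: "real \<Rightarrow> complex \<Rightarrow> real ^ 'm::finite"
  assumes I: "open I" and family: "smooth_conformal_family \<omega>1 \<omega>2 I f"
    and lift: "\<And>s. s \<in> I \<Longrightarrow> normalized_lift \<omega>1 \<omega>2 (f s) (\<psi> s)"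
  shows "smooth_family I (\<lambda>s p. cvec (\<psi> s p) $ i)"
proof -
  let ?F = "\<lambda>(t, p). f t p"
  have cyl: "open (I \<times> (UNIV :: complex set))" using I by (simp add: open_Times)
  have F: "smooth_on (I \<times> UNIV) ?F" and imm: "\<And>s. s \<in> I \<Longrightarrow> conformal_immersion \<omega>1 \<omega>2 (f s)"
    using family by (auto simp: smooth_conformal_family_def)
  define \<rho> where "\<rho> x = dir_deriv (0, 1) ?F x \<bullet> dir_deriv (0, 1) ?F x" for x
  have smooth_\<rho>: "smooth_on (I \<times> UNIV) \<rho>"
    unfolding \<rho>_def
    by (intro smooth_on_bilinear[OF bounded_bilinear_inner] cyl smooth_on_dir_deriv F)
  have slice: "dir_deriv 1 (f s) p = dir_deriv (0, 1) ?F (s, p)" if "s \<in> I" for s p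
  proof -
    have "bounded_linear (\<lambda>p::complex. (0::real, p))"
      by (intro bounded_linear_Pair bounded_linear_zero bounded_linear_ident)
    from dir_deriv_affine(1)[OF this, where f = ?F and a = "(s, 0)" and v = 1 and x = p]
    show ?thesis using smooth_on_differentiable[OF F] that by simp
  qed
  have factor: "\<rho> (s, p) > 0" "\<psi> s p $ None = \<rho> (s, p) powr (- (1 / 2))"
    "\<psi> s p $ Some k = \<rho> (s, p) powr (- (1 / 2)) * f s p $ k" if "s \<in> I" for s p k
    using normalized_lift_factor[OF lift[OF that], of p] imm[OF that] smooth_on_differentiable[of
        UNIV "f s" p]
    by (auto simp: conformal_immersion_def \<rho>_def slice[OF that])
  have scale: "smooth_on (I \<times> UNIV) (\<lambda>x. \<rho> x powr (- (1 / 2)))"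
    using factor(1) by (intro smooth_on_powr cyl smooth_\<rho>) auto
  have "smooth_on (I \<times> UNIV) (\<lambda>x. (\<lambda>(s, p). \<psi> s p $ i) x)"
  proof (cases i)
    case None
    show ?thesis unfolding None
      by (subst smooth_on_cong_open[OF cyl, where g = "\<lambda>x. \<rho> x powr (- (1 / 2))"])
        (auto simp: factor(2) scale)
  next
    case (Some k)
    have "smooth_on (I \<times> UNIV) (\<lambda>x. \<rho> x powr (- (1 / 2)) * ?F x $ k)"
      by (intro smooth_on_bilinear[OF bounded_bilinear_mult] scale cyl smooth_on_linear[OF
          bounded_linear_vec_nth] F)
    then show ?thesis unfolding Some
      by (subst smooth_on_cong_open[OF cyl, where g = "\<lambda>x. \<rho> x powr (- (1 / 2)) * ?F x $ k"])
        (auto simp: factor(3))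
  qed
  from smooth_on_linear[OF bounded_linear_of_real cyl this]
  show ?thesis unfolding smooth_family_def by (simp add: cvec_nth case_prod_unfold)
qed

lemma normalized_lift_conformal_lift:
  "normalized_lift \<omega>1 \<omega>2 f \<psi> \<Longrightarrow> conformal_lift \<psi>"
  by unfold_locales (auto simp: normalized_lift_def forward_light_cone_def)

text \<open>Differentiability of the complexified curve gives that of the real one, by taking real
  parts; so the vector derivative on the left is the actual derivative.\<close>

lemma cvec_vector_derivative:
  fixes y :: "real \<Rightarrow> real ^ 'k::finite"
  assumes "((\<lambda>s. cvec (y s)) has_vector_derivative v) (at t)"
  shows "cvec (vector_derivative y (at t)) = v"
proof -
  have c: "((\<lambda>s. complex_of_real (y s $ i)) has_vector_derivative v $ i) (at t)" for i
    using bounded_linear.has_vector_derivative[OF bounded_linear_vec_nth assms, of i]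
      by (simp add: cvec_nth)
  have "((\<lambda>s. Im (complex_of_real (y s $ i))) has_vector_derivative Im (v $ i)) (at t)" for i
    by (rule bounded_linear.has_vector_derivative[OF bounded_linear_Im c])
  then have Im: "Im (v $ i) = 0" for i
    using vector_derivative_unique_at[OF _ has_vector_derivative_const] by fastforce
  have "((\<lambda>s. Re (complex_of_real (y s $ i))) has_vector_derivative Re (v $ i)) (at t)" for i
    by (rule bounded_linear.has_vector_derivative[OF bounded_linear_Re c])
  then have "(y has_vector_derivative (\<chi> i. Re (v $ i))) (at t)"
    by (intro has_vector_derivative_vec) simp
  then have "vector_derivative y (at t) = (\<chi> i. Re (v $ i))" by (rule vector_derivative_at)
  then show ?thesis by (simp add: vec_eq_iff cvec_nth complex_eq_iff Im)
qed

section \<open>The flow preserves isothermic surfaces\<close>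

text \<open>The time derivative of \<open>\<kappa>\<close> minus its conjugate is \<open>L T\<close> plus a multiple of \<open>x\<close>, which is
  tangential by \<open>L_conformal_variation\<close>.\<close>

lemma isothermic_D_t_hopf_real:
  fixes f :: "real \<Rightarrow> complex \<Rightarrow> real ^ 'm::finite"
  assumes lattice: "lattice_basis \<omega>1 \<omega>2" and I: "open I" and t: "t \<in> I"
    and family: "smooth_conformal_family \<omega>1 \<omega>2 I f"
    and lift: "\<And>s. s \<in> I \<Longrightarrow> normalized_lift \<omega>1 \<omega>2 (f s) (\<psi> s)"
    and variation: "normal_variation \<psi> t (\<lambda>p. 2 *s Re_Dz_hopf (\<psi> t) p)"
    and isothermic: "isothermic (\<psi> t)"
  shows "Im_vec (D_t \<psi> (\<lambda>s. hopf (\<psi> s)) t p) = 0"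
proof -
  interpret isothermic_lift "\<psi> t"
    using normalized_lift_conformal_lift[OF lift[OF t]] isothermic
    by (simp add: isothermic_lift_def isothermic_lift_axioms_def)
  let ?X = "\<lambda>s. complexified (\<psi> s)"
  have X: "smooth_family I (\<lambda>s p. ?X s p $ i)" for i
    by (rule smooth_family_lift[OF I family lift])
  define T where "T = (\<lambda>p. \<chi> i. dt (\<lambda>s p. ?X s p $ i) t p)"
  note T_deriv = dt_vec[OF I X t, folded T_def]
  have T_vsmooth [simp]: "vsmooth T" by (rule T_deriv(2))
  have Xz: "smooth_family I (\<lambda>s p. dz_vec (?X s) p $ i)"
    and Xw: "smooth_family I (\<lambda>s p. dzbar_vec (?X s) p $ i)" for i
    using smooth_family_dz[OF I X] smooth_family_dzbar[OF I X] by simp_all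
  have T_z: "(\<lambda>p. \<chi> i. dt (\<lambda>s p. dz_vec (?X s) p $ i) t p) = dz_vec T"
    and T_w: "(\<lambda>p. \<chi> i. dt (\<lambda>s p. dzbar_vec (?X s) p $ i) t p) = dzbar_vec T"
    using vector_derivative_unique_at[OF dt_vec(1)[OF I Xz t] T_deriv(3)]
      vector_derivative_unique_at[OF dt_vec(1)[OF I Xw t] T_deriv(4)] by (simp_all add: fun_eq_iff)
  have d_x: "((\<lambda>s. ?X s p) has_vector_derivative T p) (at t)"
    and d_xz: "((\<lambda>s. dz_vec (?X s) p) has_vector_derivative dz_vec T p) (at t)"
    and d_xzz: "((\<lambda>s. dz_vec (dz_vec (?X s)) p) has_vector_derivative dz_vec (dz_vec T) p) (at t)"
    and d_xzw: "((\<lambda>s. dz_vec (dzbar_vec (?X s)) p) has_vector_derivative dz_vec (dzbar_vec T) p)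
        (at t)" for p
    using T_deriv(3) dt_vec(3)[OF I Xz t] dt_vec(3)[OF I Xw t] unfolding T_z T_w
    by (simp_all only: T_def dt_vec(1)[OF I X t])
  have cvec_T: "cvec (vector_derivative (\<lambda>s. \<psi> s p) (at t)) = T p" for p
    by (rule cvec_vector_derivative[OF d_x])
  have cnj_T [simp]: "cnj_vec (T p) = T p" for p
    unfolding cvec_T[symmetric] by simp
  have cnj_Tz: "cnj_vec (dz_vec T p) = dzbar_vec T p" for p
    using dzbar_vec_cnj[OF T_vsmooth] by (simp add: fun_eq_iff)
  have cnj_Tzz: "cnj_vec (dz_vec (dz_vec T) p) = dzbar_vec (dzbar_vec T) p" for p
    using dzbar_vec_cnj[of "dz_vec T"] by (simp add: cnj_Tz fun_eq_iff)
  obtain a b where T_eq: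
      "\<And>p. T p = complex_of_real (a p) *s x p + b p *s xz p + cnj (b p) *s xw p + \<sigma> p"
    using variation unfolding normal_variation_def cvec_T \<sigma>_def by blast
  \<comment> \<open>half the time derivative of \<open>\<langle>xz, xz\<rangle> = 0\<close>, which holds for all times in \<open>I\<close>\<close>
  have conformal: "lorentz (dz_vec T p) (xz p) = 0" for p
  proof -
    have "((\<lambda>s. lorentz (dz_vec (?X s) p) (dz_vec (?X s) p)) has_vector_derivative
        lorentz (dz_vec T p) (xz p) + lorentz (xz p) (dz_vec T p)) (at t)"
      by (rule has_vector_derivative_lorentz[OF d_xz d_xz])
    then have "((\<lambda>s. 0) has_vector_derivative
        lorentz (dz_vec T p) (xz p) + lorentz (xz p) (dz_vec T p)) (at t)"
    proof (rule has_vector_derivative_transform_within_open[OF _ I t])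
      show "lorentz (dz_vec (?X s) p) (dz_vec (?X s) p) = 0" if "s \<in> I" for s
        by (rule conformal_lift.xz_xz[OF normalized_lift_conformal_lift[OF lift[OF that]]])
    qed
    then have "lorentz (dz_vec T p) (xz p) + lorentz (xz p) (dz_vec T p) = 0"
      using vector_derivative_unique_at[OF _ has_vector_derivative_const] by blast
    then show ?thesis by (simp add: lorentz_commute[of "xz p"])
  qed
  have per: "doubly_periodic \<omega>1 \<omega>2 (\<psi> s)" if "s \<in> I" for s
    using lift[OF that] by (simp add: normalized_lift_def)
  have "T (q + w) = T q" if "\<And>s. s \<in> I \<Longrightarrow> \<psi> s (q + w) = \<psi> s q" for q w
  proof -
    have "((\<lambda>s. ?X s q) has_vector_derivative T (q + w)) (at t)"
      by (rule has_vector_derivative_transform_within_open[OF d_x I t]) (simp add: that)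
    then show ?thesis using vector_derivative_unique_at d_x by blast
  qed
  then have per_T: "doubly_periodic \<omega>1 \<omega>2 T"
    using per by (simp add: doubly_periodic_def)
  have LT: "L T p \<in> V_fibre (\<psi> t) p"
    by (rule L_conformal_variation[OF lattice per[OF t] per_T T_vsmooth conformal T_eq])
  define c' where "c'
      = 4 * (lorentz (dz_vec (dz_vec T) p) (xzw p)
      + lorentz (dz_vec xz p) (dz_vec (dzbar_vec T) p))"
  have hopf_eq: "hopf (\<psi> s) p = dz_vec (dz_vec (?X s)) p
      + (4 * lorentz (dz_vec (dz_vec (?X s)) p) (dz_vec (dzbar_vec (?X s)) p) / 2) *s ?X s p"
          if "s \<in> I" for s
    by (simp add: hopf_def conformal_lift.schwarzian_eq[OF normalized_lift_conformal_lift[OF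
        lift[OF that]]])
  have "((\<lambda>s. dz_vec (dz_vec (?X s)) p
      + (4 * lorentz (dz_vec (dz_vec (?X s)) p) (dz_vec (dzbar_vec (?X s)) p) / 2) *s ?X s p)
    has_vector_derivative dz_vec (dz_vec T) p + ((c p / 2) *s T p + (c' / 2) *s x p)) (at t)"
    unfolding c'_def c_eq
    by (intro has_vector_derivative_add has_vector_derivative_scale has_vector_derivative_divide
        has_vector_derivative_mult_right has_vector_derivative_lorentz d_x d_xzz d_xzw)
  then have "((\<lambda>s. hopf (\<psi> s) p) has_vector_derivative
      dz_vec (dz_vec T) p + ((c p / 2) *s T p + (c' / 2) *s x p)) (at t)"
    by (rule has_vector_derivative_transform_within_open[OF _ I t]) (simp add: hopf_eq)
  then have \<kappa>_t: "vector_derivative (\<lambda>s. hopf (\<psi> s) p) (at t) =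
      dz_vec (dz_vec T) p + ((c p / 2) *s T p + (c' / 2) *s x p)" (is "_ = ?v")
    by (rule vector_derivative_at)
  \<comment> \<open>conjugation fixes \<open>T\<close> and \<open>x\<close> and exchanges the two pure second derivatives of \<open>T\<close>\<close>
  have "?v - cnj_vec ?v = L T p + ((c' - cnj c') / 2) *s x p"
    by (simp add: cnj_Tzz L_def e_def) (simp add: vec_eq_iff algebra_simps diff_divide_distrib)
  also have "\<dots> \<in> V_fibre (\<psi> t) p" by (intro V_intros LT)
  finally show ?thesis unfolding D_t_def \<kappa>_t by (rule normal_proj_real)
qed

theorem mainTheorem6:
  fixes n :: nat and \<omega>1 \<omega>2 :: complex
  assumes "n \<ge> 3" and "CARD('m::finite) = n + 1" and "lattice_basis \<omega>1 \<omega>2"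
  shows
    "(\<forall>(I :: real set) (f :: real \<Rightarrow> complex \<Rightarrow> real ^ 'm) (\<psi> :: real \<Rightarrow> complex \<Rightarrow> real ^ 'm option) t.
        open I \<and> is_interval I \<and> t \<in> I \<and>
        smooth_conformal_family \<omega>1 \<omega>2 I f \<and>
        (\<forall>s\<in>I. normalized_lift \<omega>1 \<omega>2 (f s) (\<psi> s)) \<and>
        (\<forall>s\<in>I. normal_variation \<psi> s (\<lambda>p. 2 *s Re_Dz_hopf (\<psi> s) p)) \<and>
        isothermic (\<psi> t) \<longrightarrow>
        (\<forall>p. Im_vec (D_t \<psi> (\<lambda>s. hopf (\<psi> s)) t p) = 0)) \<and>
     (\<forall>(f :: complex \<Rightarrow> real ^ 'm) (\<psi> :: complex \<Rightarrow> real ^ 'm option).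
        conformal_immersion \<omega>1 \<omega>2 f \<and> normalized_lift \<omega>1 \<omega>2 f \<psi> \<and> isothermic \<psi> \<longrightarrow>
        (let b = (\<lambda>p. lorentz (hopf \<psi> p) (hopf \<psi> p) + schwarzian \<psi> p / 4);
             \<sigma> = (\<lambda>p. 2 *s Re_Dz_hopf \<psi> p)
         in \<forall>p. dz (\<lambda>q. cnj (b q)) p = 2 * lorentz (\<sigma> p) (hopf \<psi> p)))"
proof (intro conjI allI impI)
  fix I :: "real set" and f :: "real \<Rightarrow> complex \<Rightarrow> real ^ 'm" and \<psi> ::
      "real \<Rightarrow> complex \<Rightarrow> real ^ 'm option" and t p
  assume "open I \<and> is_interval I \<and> t \<in> I \<and>
        smooth_conformal_family \<omega>1 \<omega>2 I f \<and>
        (\<forall>s\<in>I. normalized_lift \<omega>1 \<omega>2 (f s) (\<psi> s)) \<and>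
        (\<forall>s\<in>I. normal_variation \<psi> s (\<lambda>p. 2 *s Re_Dz_hopf (\<psi> s) p)) \<and>
        isothermic (\<psi> t)"
  then show "Im_vec (D_t \<psi> (\<lambda>s. hopf (\<psi> s)) t p) = 0"
    by (intro isothermic_D_t_hopf_real[OF assms(3)]) auto
next
  fix f :: "complex \<Rightarrow> real ^ 'm" and \<psi> :: "complex \<Rightarrow> real ^ 'm option"
  assume "conformal_immersion \<omega>1 \<omega>2 f \<and> normalized_lift \<omega>1 \<omega>2 f \<psi> \<and> isothermic \<psi>"
  then interpret isothermic_lift \<psi>
    by (auto simp: isothermic_lift_def isothermic_lift_axioms_def intro:
        normalized_lift_conformal_lift)
  show "let b = (\<lambda>p. lorentz (hopf \<psi> p) (hopf \<psi> p) + schwarzian \<psi> p / 4);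
             \<sigma> = (\<lambda>p. 2 *s Re_Dz_hopf \<psi> p)
         in \<forall>p. dz (\<lambda>q. cnj (b q)) p = 2 * lorentz (\<sigma> p) (hopf \<psi> p)"
    using explicit_b unfolding h_def c_def \<kappa>_def \<sigma>_def Let_def by blast
qed

end
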